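(* Let $\lambda$, $\kappa$, $\Theta_0$, $M_0$ and $\{P_{\boldsymbol\theta}\}_{\boldsymbol\theta\in\Theta_0}$ be as described in the context (regular full natural exponential family). Let $\nu$ be a probability measure on $\Theta_0$ whose support, in the relative topology of $\Theta_0$, is $\Theta$. Let $\{\bar{\boldsymbol x}_n\}_{n\in\mathbb N}$ be a sequence in $\mathbb R^d$ converging to some $\boldsymbol\mu_0\in M_0$, and let $\boldsymbol\theta_0\in\Theta_0$ be the point with $\boldsymbol\mu_0=\nabla\kappa(\boldsymbol\theta_0)$. Then the sequence of probability measures on $\Theta$ given (for all $n$ with $\bar{\boldsymbol x}_n\in M_0$, hence for all large $n$) by $$\pi_n(A|\bar{\boldsymbol x}_n)=\frac{\int_A \exp(n\ell(\boldsymbol\theta;\bar{\boldsymbol x}_n))\,\nu(d\boldsymbol\theta)}{\int_\Theta \exp(n\ell(\boldsymbol\theta;\bar{\boldsymbol x}_n))\,\nu(d\boldsymbol\theta)},\qquad A\subset\Theta \text{ Borel},$$ satisfies a large deviation principle on $\Theta$ with rate function $$J(\boldsymbol\theta)=D(\boldsymbol\theta_0||\boldsymbol\theta)-D(\boldsymbol\theta_0||\Pi_\Theta(\boldsymbol\theta_0)),\qquad \boldsymbol\theta\in\Theta,$$ where $\Pi_\Theta(\boldsymbol\theta_0)$ is any $m$-projection of $\boldsymbol\theta_0$ on $\Theta$.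
   Context: Setting: $\lambda$ is a $\sigma$-finite Borel measure on $\mathbb R^d$, not concentrated on a proper affine submanifold of $\mathbb R^d$. Its cumulant generating function is $\kappa(\boldsymbol\theta)=\log\int_{\mathbb R^d}e^{\boldsymbol\theta\cdot\boldsymbol x}\lambda(d\boldsymbol x)\in(-\infty,+\infty]$, $\boldsymbol\theta\in\mathbb R^d$, and its domain of finiteness $\Theta_0=\{\boldsymbol\theta:\kappa(\boldsymbol\theta)<\infty\}$ is assumed to be (nonempty and) open. The full natural exponential family generated by $\lambda$ is $\frac{dP_{\boldsymbol\theta}}{d\lambda}(\boldsymbol x)=e^{\boldsymbol\theta\cdot\boldsymbol x-\kappa(\boldsymbol\theta)}$, $\boldsymbol\theta\in\Theta_0$. $M_0=\nabla\kappa(\Theta_0)$, which is the interior of the convex support $C(\lambda)$ of $\lambda$ (the smallest closed convex set whose complement is $\lambda$-null); $\nabla\kappa:\Theta_0\to M_0$ is a diffeomorphism. The log-likelihood function is $\ell(\boldsymbol\theta;\boldsymbol t)=\boldsymbol\theta\cdot\boldsymbol t-\kappa(\boldsymbol\theta)$. For $\boldsymbol\theta_1,\boldsymbol\theta_2\in\Theta_0$, $D(\boldsymbol\theta_1||\boldsymbol\theta_2)$ denotes the Kullback-Leibler divergence $D(P_{\boldsymbol\theta_1}||P_{\boldsymbol\theta_2})=\int\log\frac{dP_{\boldsymbol\theta_1}}{dP_{\boldsymbol\theta_2}}\,dP_{\boldsymbol\theta_1}=\kappa(\boldsymbol\theta_2)-\kappa(\boldsymbol\theta_1)-(\boldsymbol\theta_2-\boldsymbol\theta_1)\cdot\nabla\kappa(\boldsymbol\theta_1)$.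 An $m$-projection of $\boldsymbol\theta_0$ on $\Theta$ is any minimizer of $\boldsymbol\theta\mapsto D(\boldsymbol\theta_0||\boldsymbol\theta)$ over $\boldsymbol\theta\in\Theta$. A sequence $\{\phi_n\}$ of probability measures on a topological space $\mathcal X$ satisfies the large deviation principle (LDP) with rate function $I:\mathcal X\to[0,+\infty]$ if $I$ is lower semi-continuous with compact sub-level sets $\{I\le\eta\}$, $\eta\ge0$ (all rate functions are good), and for every Borel $A\subset\mathcal X$, $-\inf_{\mathrm{int}(A)}I\le\liminf_n n^{-1}\ln\phi_n(A)\le\limsup_n n^{-1}\ln\phi_n(A)\le-\inf_{\bar A}I$. *)

theory Defs
  imports "HOL-Probability.Probability"
begin

section \<open>Large deviation principles\<close>

definition ln_ennreal :: "ennreal \<Rightarrow> ereal" where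
  "ln_ennreal x =
     (if x = 0 then -\<infinity> else if x = \<infinity> then \<infinity> else ereal (ln (enn2real x)))"

definition borel_sets_of :: "'a topology \<Rightarrow> 'a set set" where
  "borel_sets_of X = sigma_sets (topspace X) {U. openin X U}"

definition lower_semicontinuous_map :: "'a topology \<Rightarrow> ('a \<Rightarrow> ereal) \<Rightarrow> bool" where
  "lower_semicontinuous_map X I \<longleftrightarrow> (\<forall>c::real. openin X {x \<in> topspace X. ereal c < I x})"

text \<open>Rate functions are good: all sub-level sets are compact.
  Values of \<open>I\<close> outside \<open>topspace X\<close> are irrelevant.\<close>

definition good_rate_function :: "'a topology \<Rightarrow> ('a \<Rightarrow> ereal) \<Rightarrow> bool" where
  "good_rate_function X I \<longleftrightarrow>
     (\<forall>x\<in>topspace X. 0 \<le> I x) \<and>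
     lower_semicontinuous_map X I \<and>
     (\<forall>\<eta>::real. 0 \<le> \<eta> \<longrightarrow> compactin X {x \<in> topspace X. I x \<le> ereal \<eta>})"

text \<open>The measures are required to be Borel probability measures on \<open>X\<close> only for all large \<open>n\<close>,
  so that sequences defined only from some index on are covered; the asymptotic bounds are
  insensitive to finitely many terms. The infimum over the empty set is \<open>\<infinity>\<close>.\<close>

definition large_deviation_principle ::
    "'a topology \<Rightarrow> (nat \<Rightarrow> 'a measure) \<Rightarrow> ('a \<Rightarrow> ereal) \<Rightarrow> bool" where
  "large_deviation_principle X \<phi> I \<longleftrightarrow>
     (\<forall>\<^sub>F n in sequentially. prob_space (\<phi> n) \<and>
        space (\<phi> n) = topspace X \<and> sets (\<phi> n) = borel_sets_of X) \<and>
     good_rate_function X I \<and>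
     (\<forall>A\<in>borel_sets_of X.
        - (INF x\<in>X interior_of A. I x)
          \<le> liminf (\<lambda>n. ereal (1 / real n) * ln_ennreal (emeasure (\<phi> n) A)) \<and>
        liminf (\<lambda>n. ereal (1 / real n) * ln_ennreal (emeasure (\<phi> n) A))
          \<le> limsup (\<lambda>n. ereal (1 / real n) * ln_ennreal (emeasure (\<phi> n) A)) \<and>
        limsup (\<lambda>n. ereal (1 / real n) * ln_ennreal (emeasure (\<phi> n) A))
          \<le> - (INF x\<in>X closure_of A. I x))"

section \<open>Natural exponential families\<close>

definition not_affinely_concentrated :: "'a::euclidean_space measure \<Rightarrow> bool" where
  "not_affinely_concentrated lam \<longleftrightarrow>
     (\<forall>S. affine S \<and> S \<noteq> UNIV \<longrightarrow> emeasure lam (UNIV - S) \<noteq> 0)"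

definition cgf :: "'a::euclidean_space measure \<Rightarrow> 'a \<Rightarrow> ereal" where
  "cgf lam \<theta> = ln_ennreal (\<integral>\<^sup>+x. ennreal (exp (\<theta> \<bullet> x)) \<partial>lam)"

definition natural_domain :: "'a::euclidean_space measure \<Rightarrow> 'a set" where
  "natural_domain lam = {\<theta>. cgf lam \<theta> < \<infinity>}"

text \<open>The real-valued version; meaningful on \<open>natural_domain\<close>
  (\<open>real_of_ereal\<close> sends infinite values to 0).\<close>

definition cgf_real :: "'a::euclidean_space measure \<Rightarrow> 'a \<Rightarrow> real" where
  "cgf_real lam \<theta> = real_of_ereal (cgf lam \<theta>)"

definition nef :: "'a::euclidean_space measure \<Rightarrow> 'a \<Rightarrow> 'a measure" where
  "nef lam \<theta> = density lam (\<lambda>x. ennreal (exp (\<theta> \<bullet> x - cgf_real lam \<theta>)))"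

definition grad :: "('a::euclidean_space \<Rightarrow> real) \<Rightarrow> 'a \<Rightarrow> 'a" where
  "grad f x = (THE g. GDERIV f x :> g)"

definition mean_domain :: "'a::euclidean_space measure \<Rightarrow> 'a set" where
  "mean_domain lam = grad (cgf_real lam) ` natural_domain lam"

definition log_likelihood :: "'a::euclidean_space measure \<Rightarrow> 'a \<Rightarrow> 'a \<Rightarrow> real" where
  "log_likelihood lam \<theta> t = \<theta> \<bullet> t - cgf_real lam \<theta>"

text \<open>\<open>KL_divergence b M N\<close> integrates \<open>log b (dN/dM)\<close> with respect to \<open>N\<close>,
  so its arguments are in the opposite order to the usual \<open>D(N || M)\<close>.\<close>

definition kl :: "'a::euclidean_space measure \<Rightarrow> 'a \<Rightarrow> 'a \<Rightarrow> real" where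
  "kl lam \<theta>1 \<theta>2 = KL_divergence (exp 1) (nef lam \<theta>2) (nef lam \<theta>1)"

definition m_projection :: "'a::euclidean_space measure \<Rightarrow> 'a set \<Rightarrow> 'a \<Rightarrow> 'a \<Rightarrow> bool" where
  "m_projection lam \<Theta> \<theta>0 \<theta>' \<longleftrightarrow> \<theta>' \<in> \<Theta> \<and> (\<forall>\<theta>\<in>\<Theta>. kl lam \<theta>0 \<theta>' \<le> kl lam \<theta>0 \<theta>)"

section \<open>Prior and posterior\<close>

definition support_in :: "'a topology \<Rightarrow> 'a measure \<Rightarrow> 'a set" where
  "support_in X M = {x \<in> topspace X. \<forall>U. openin X U \<and> x \<in> U \<longrightarrow> emeasure M U > 0}"

text \<open>If the set function below is not a measure (e.g. if the denominator is infinite),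
  then \<open>measure_of\<close> yields the null measure, which is not a probability measure.\<close>

definition posterior ::
    "'a::euclidean_space measure \<Rightarrow> 'a measure \<Rightarrow> 'a set \<Rightarrow> nat \<Rightarrow> 'a \<Rightarrow> 'a measure" where
  "posterior lam \<nu> \<Theta> n t =
     measure_of \<Theta> (borel_sets_of (top_of_set \<Theta>))
       (\<lambda>A. (\<integral>\<^sup>+\<theta>\<in>A. ennreal (exp (real n * log_likelihood lam \<theta> t)) \<partial>\<nu>) /
            (\<integral>\<^sup>+\<theta>\<in>\<Theta>. ennreal (exp (real n * log_likelihood lam \<theta> t)) \<partial>\<nu>))"

end

theory Submission
  imports Defs
begin

text \<open>
  Write \<open>f \<theta> = \<theta> \<bullet> t - \<kappa> \<theta>\<close> for the limiting log-likelihood, where \<open>t = \<mu>0\<close>. Up to an additive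
  constant, \<open>- f\<close> is the divergence from \<open>\<theta>0\<close>, so that an m-projection is a maximiser of \<open>f\<close> over
  the support \<open>\<Theta>\<close> of the prior and the rate function is \<open>max f - f\<close>. The claim is Laplace's method:
  the mass that \<open>exp (n f\<^sub>n)\<close> puts on a set \<open>A\<close> grows at the exponential rate \<open>sup f\<close> over \<open>A\<close>, up to
  the difference between interior and closure. Here \<open>f\<^sub>n\<close>, the log-likelihood at the \<open>n\<close>-th data
  point, varies with \<open>n\<close>, and \<open>\<Theta>\<close> need not be compact, so two points need care.

  For the upper bound, \<open>f\<^sub>n\<close> must not exceed \<open>sup f\<close> by more than a small amount, uniformly on an
  unbounded set. On a bounded part this is just \<open>f\<^sub>n \<theta> - f \<theta> = \<theta> \<bullet> (x\<^sub>n - t)\<close>. Far out it follows from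
  coercivity, \<open>\<kappa> \<theta> - \<theta> \<bullet> t \<ge> e * norm \<theta> - C\<close> (\<open>cgf_coercive\<close>), which beats any small linear
  perturbation. Coercivity holds because the set of means is open (\<open>open_mean_domain\<close>): each mean
  vector bounds \<open>\<kappa>\<close> from below by an affine function, and mean vectors slightly displaced from \<open>t\<close> in
  every coordinate direction are available. Coercivity also bounds the sub-level sets of the rate
  function; they are closed in the whole space by Fatou's lemma (\<open>compact_sublevel\<close>), although the
  natural domain is only open.

  For the lower bound, every nonempty relatively open subset of \<open>\<Theta>\<close> has positive prior mass, and \<open>f\<^sub>n\<close> is
  uniformly close to \<open>f \<theta>\<close> near any given \<open>\<theta>\<close>.

  The geometry of \<open>\<kappa>\<close> comes from one inequality: \<open>\<kappa>\<close> lies strictly above the affine function through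
  \<open>\<theta>\<close> whose slope is the mean of the distribution with parameter \<open>\<theta>\<close> (\<open>cgf_gt_tangent\<close>). Together with
  continuity of the mean in \<open>\<theta>\<close>, it identifies the mean as the gradient (\<open>GDERIV_cgf\<close>), and it
  makes openness of the set of means a statement about interior minima of \<open>\<theta> \<mapsto> \<kappa> \<theta> - \<theta> \<bullet> t\<close>.
\<close>

section \<open>Logarithmic asymptotics in extended reals\<close>

lemma ln_ennreal_le: "x \<le> ennreal (exp y) \<Longrightarrow> ln_ennreal x \<le> ereal y"
  using ln_le_cancel_iff[of "enn2real x" "exp y"]
  by (cases x) (auto simp: ln_ennreal_def top_unique)

lemma le_ln_ennreal: "ennreal (exp y) \<le> x \<Longrightarrow> ereal y \<le> ln_ennreal x"
  by (cases x) (auto simp: ln_ennreal_def ln_ge_iff)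

lemma ennreal_inverse_antimono:
  fixes a b :: ennreal
  assumes "a \<le> b"
  shows "inverse b \<le> inverse a"
proof (cases "a = 0 \<or> b = top")
  case False
  with assms obtain r s where "a = ennreal r" "b = ennreal s" "0 < r" "r \<le> s"
    by (cases a; cases b) (auto simp: top_unique)
  then show ?thesis by (simp add: inverse_ennreal ennreal_leI le_imp_inverse_le)
qed auto

lemma divide_mono_ennreal:
  fixes a b c d :: ennreal
  shows "a \<le> b \<Longrightarrow> d \<le> c \<Longrightarrow> a / c \<le> b / d"
  unfolding divide_ennreal_def by (intro mult_mono ennreal_inverse_antimono) auto

lemma scaled_ln_ennreal_le:
  assumes "n > 0" "x \<le> ennreal (exp (real n * y))"
  shows "ereal (1 / real n) * ln_ennreal x \<le> ereal y"
  using ereal_mult_left_mono[OF ln_ennreal_le[OF assms(2)], of "ereal (1 / real n)"] assms(1) by simp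

lemma le_scaled_ln_ennreal:
  assumes "n > 0" "ennreal (exp (real n * y)) \<le> x"
  shows "ereal y \<le> ereal (1 / real n) * ln_ennreal x"
  using ereal_mult_left_mono[OF le_ln_ennreal[OF assms(2)], of "ereal (1 / real n)"] assms(1) by simp

lemma large_deviation_principle_cong:
  assumes eq: "\<And>x. x \<in> topspace X \<Longrightarrow> I x = I' x"
  shows "large_deviation_principle X \<phi> I \<longleftrightarrow> large_deviation_principle X \<phi> I'"
proof -
  have inf: "(INF x\<in>B. I x) = (INF x\<in>B. I' x)" if "B \<subseteq> topspace X" for B
    using that eq by (intro INF_cong) auto
  have sets: "{x \<in> topspace X. P (I x)} = {x \<in> topspace X. P (I' x)}" for P
    using eq by auto
  have "good_rate_function X I \<longleftrightarrow> good_rate_function X I'"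
    using eq sets[of "\<lambda>y. ereal _ < y"] sets[of "\<lambda>y. y \<le> ereal _"]
    by (simp add: good_rate_function_def lower_semicontinuous_map_def)
  then show ?thesis
    by (simp add: large_deviation_principle_def inf interior_of_subset_topspace closure_of_subset_topspace)
qed

section \<open>The support of a Borel measure on a subspace\<close>

lemma borel_sets_of_top_of_set:
  fixes S :: "'a::topological_space set"
  assumes "S \<in> sets borel"
  shows "borel_sets_of (top_of_set S) = sets (restrict_space borel S)"
proof -
  have "{U. openin (top_of_set S) U} = (\<inter>) S ` {U. open U}"
    by (auto simp: openin_open)
  then show ?thesis
    using assms sigma_sets_Int[of S UNIV "{U. open U}"]
    by (simp add: borel_sets_of_def sets_restrict_space borel_def)
qed

text \<open>The complement of the support is a union of null open sets, in general an uncountable one; by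
  the Lindelof property countably many of them suffice, so the support carries the whole measure.\<close>

lemma
  fixes S :: "'a::second_countable_topology set"
  assumes sets_M: "sets M = sets (restrict_space borel S)"
  shows closedin_support_in: "closedin (top_of_set S) (support_in (top_of_set S) M)"
    and emeasure_off_support_in: "emeasure M (S - support_in (top_of_set S) M) = 0"
proof -
  define F where "F = {U. openin (top_of_set S) U \<and> emeasure M U = 0}"
  have eq: "support_in (top_of_set S) M = S - \<Union>F"
    by (auto simp: support_in_def F_def zero_less_iff_neq_zero)
  have "openin (top_of_set S) (\<Union>F)" by (rule openin_Union) (simp add: F_def)
  then show "closedin (top_of_set S) (support_in (top_of_set S) M)"
    unfolding eq by (simp add: closedin_diff)
  have sub: "\<Union>F \<subseteq> S" using openin_subset by (fastforce simp: F_def)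
  obtain F' where F': "F' \<subseteq> F" "countable F'" "\<Union>F' = \<Union>F"
    using Lindelof_openin[of F S] by (auto simp: F_def)
  have "U \<in> null_sets M" if "U \<in> F'" for U
  proof
    have U: "openin (top_of_set S) U" "emeasure M U = 0" using F'(1) that by (auto simp: F_def)
    show "emeasure M U = 0" by fact
    obtain T where "open T" "U = S \<inter> T" using U(1) by (auto simp: openin_open)
    then show "U \<in> sets M" unfolding sets_M sets_restrict_space by (metis borel_open imageI)
  qed
  then have "\<Union>F' \<in> null_sets M"
    using null_sets_UN'[OF F'(2), of "\<lambda>U. U"] by simp
  then show "emeasure M (S - support_in (top_of_set S) M) = 0"
    using F'(3) sub by (simp add: eq double_diff null_setsD1)
qed

section \<open>Exponential moments\<close>

locale regular_exponential_family =
  fixes lam :: "'a::euclidean_space measure"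
  assumes sets_lam [measurable_cong]: "sets lam = sets borel"
    and sigma_finite_lam: "sigma_finite_measure lam"
    and not_affine: "not_affinely_concentrated lam"
    and open_domain: "open (natural_domain lam)"
begin

abbreviation \<kappa> :: "'a \<Rightarrow> real" where "\<kappa> \<equiv> cgf_real lam"
abbreviation \<Theta>0 :: "'a set" where "\<Theta>0 \<equiv> natural_domain lam"

lemma space_lam [simp]: "space lam = UNIV"
  using sets_eq_imp_space_eq[OF sets_lam] by simp

text \<open>The empty set is affine, so a measure that is not affinely concentrated is nonzero. Hence the
  cumulant generating function never takes the value \<open>-\<infinity>\<close>, and finiteness of \<open>\<kappa>\<close> is finiteness of the
  Laplace transform.\<close>

lemma laplace_transform_nonzero: "(\<integral>\<^sup>+x. ennreal (exp (\<theta> \<bullet> x)) \<partial>lam) \<noteq> 0"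
proof
  assume "(\<integral>\<^sup>+x. ennreal (exp (\<theta> \<bullet> x)) \<partial>lam) = 0"
  then have "AE x in lam. False"
    by (subst (asm) nn_integral_0_iff_AE) auto
  then have "emeasure lam UNIV = 0"
    using AE_iff_measurable[of UNIV lam "\<lambda>_. False"] by (simp add: sets_lam)
  moreover have "emeasure lam (UNIV - {}) \<noteq> 0"
    using not_affine unfolding not_affinely_concentrated_def by (metis affine_empty empty_not_UNIV)
  ultimately show False by simp
qed

lemma natural_domain_iff: "\<theta> \<in> \<Theta>0 \<longleftrightarrow> (\<integral>\<^sup>+x. ennreal (exp (\<theta> \<bullet> x)) \<partial>lam) < \<infinity>"
  using laplace_transform_nonzero[of \<theta>]
  by (auto simp: natural_domain_def cgf_def ln_ennreal_def less_top)

lemma natural_domain_iff_integrable: "\<theta> \<in> \<Theta>0 \<longleftrightarrow> integrable lam (\<lambda>x. exp (\<theta> \<bullet> x))"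
  unfolding natural_domain_iff integrable_iff_bounded by simp

lemma nn_laplace_eq:
  assumes "\<theta> \<in> \<Theta>0"
  shows "(\<integral>\<^sup>+x. ennreal (exp (\<theta> \<bullet> x)) \<partial>lam) = ennreal (exp (\<kappa> \<theta>))"
proof -
  let ?L = "\<integral>\<^sup>+x. ennreal (exp (\<theta> \<bullet> x)) \<partial>lam"
  have fin: "?L \<noteq> \<infinity>" and pos: "?L \<noteq> 0"
    using assms laplace_transform_nonzero natural_domain_iff[of \<theta>] by auto
  then have "\<kappa> \<theta> = ln (enn2real ?L)"
    by (simp add: cgf_real_def cgf_def ln_ennreal_def)
  moreover have "enn2real ?L > 0"
    using fin pos by (simp add: enn2real_positive_iff zero_less_iff_neq_zero less_top)
  ultimately show ?thesis using fin by (simp add: less_top)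
qed

lemma laplace_eq: "\<theta> \<in> \<Theta>0 \<Longrightarrow> (\<integral>x. exp (\<theta> \<bullet> x) \<partial>lam) = exp (\<kappa> \<theta>)"
  using nn_laplace_eq[of \<theta>] by (simp add: integral_eq_nn_integral)

text \<open>The norm is at most the dimension times the largest coordinate modulus, so its exponential is
  controlled by exponentials of linear functionals. After tilting, each term on the right is an integrand of
  the Laplace transform at a nearby parameter.\<close>

lemma exp_norm_le:
  fixes x :: 'a
  assumes "0 \<le> e"
  shows "exp (e * norm x) \<le>
    (\<Sum>b\<in>Basis. exp ((e * DIM('a)) * (b \<bullet> x)) + exp (- (e * DIM('a)) * (b \<bullet> x)))"
proof -
  obtain b :: 'a where b: "b \<in> Basis" and bmax: "\<And>c. c \<in> Basis \<Longrightarrow> \<bar>x \<bullet> c\<bar> \<le> \<bar>x \<bullet> b\<bar>"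
  proof -
    have "Max ((\<lambda>c. \<bar>x \<bullet> c\<bar>) ` Basis) \<in> (\<lambda>c. \<bar>x \<bullet> c\<bar>) ` Basis"
      by (intro Max_in) auto
    then obtain b where "b \<in> Basis" "Max ((\<lambda>c. \<bar>x \<bullet> c\<bar>) ` Basis) = \<bar>x \<bullet> b\<bar>"
      by blast
    then show thesis
      using that[of b] Max_ge[of "(\<lambda>c. \<bar>x \<bullet> c\<bar>) ` Basis"] by auto
  qed
  have "norm x \<le> (\<Sum>c\<in>Basis. \<bar>x \<bullet> c\<bar>)" by (rule norm_le_l1)
  also have "\<dots> \<le> DIM('a) * \<bar>x \<bullet> b\<bar>"
    using sum_bounded_above[of Basis "\<lambda>c. \<bar>x \<bullet> c\<bar>"] bmax by simp
  finally have "e * norm x \<le> (e * DIM('a)) * \<bar>b \<bullet> x\<bar>"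
    using assms by (simp add: mult_left_mono mult.assoc inner_commute)
  then have "exp (e * norm x) \<le> exp ((e * DIM('a)) * \<bar>b \<bullet> x\<bar>)" by simp
  also have "\<dots> \<le> exp ((e * DIM('a)) * (b \<bullet> x)) + exp (- (e * DIM('a)) * (b \<bullet> x))"
    by (cases "b \<bullet> x \<ge> 0") auto
  also have "\<dots> \<le> (\<Sum>b\<in>Basis. exp ((e * DIM('a)) * (b \<bullet> x)) + exp (- (e * DIM('a)) * (b \<bullet> x)))"
    using b by (intro member_le_sum) (auto intro: add_nonneg_nonneg)
  finally show ?thesis .
qed

lemma integrable_exp_norm:
  assumes "\<theta> \<in> \<Theta>0"
  obtains e where "e > 0" "integrable lam (\<lambda>x. exp (\<theta> \<bullet> x + e * norm x))"
proof -
  obtain r where r: "r > 0" "ball \<theta> r \<subseteq> \<Theta>0"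
    using open_domain assms openE by blast
  define e where "e = r / (2 * DIM('a))"
  have e: "e > 0" "e * DIM('a) = r / 2" using r by (auto simp: e_def)
  let ?s = "\<lambda>x. (\<Sum>b\<in>Basis. exp ((\<theta> + (r/2) *\<^sub>R b) \<bullet> x) + exp ((\<theta> - (r/2) *\<^sub>R b) \<bullet> x))"
  have int: "integrable lam ?s"
  proof (intro Bochner_Integration.integrable_sum Bochner_Integration.integrable_add)
    fix b :: 'a assume "b \<in> Basis"
    then have "\<theta> + (r/2) *\<^sub>R b \<in> ball \<theta> r" "\<theta> - (r/2) *\<^sub>R b \<in> ball \<theta> r"
      using r by (auto simp: dist_norm)
    then show "integrable lam (\<lambda>x. exp ((\<theta> + (r/2) *\<^sub>R b) \<bullet> x))"
      "integrable lam (\<lambda>x. exp ((\<theta> - (r/2) *\<^sub>R b) \<bullet> x))"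
      using r natural_domain_iff_integrable by blast+
  qed
  have le: "exp (\<theta> \<bullet> x + e * norm x) \<le> ?s x" for x
  proof -
    have "exp (\<theta> \<bullet> x + e * norm x) = exp (\<theta> \<bullet> x) * exp (e * norm x)"
      by (rule exp_add)
    also have "\<dots> \<le> exp (\<theta> \<bullet> x) *
        (\<Sum>b\<in>Basis. exp ((r/2) * (b \<bullet> x)) + exp (- (r/2) * (b \<bullet> x)))"
      using exp_norm_le[of e x] e by (intro mult_left_mono) auto
    also have "\<dots> = ?s x"
      by (simp add: sum_distrib_left inner_add_left inner_diff_left distrib_left mult_exp_exp)
    finally show ?thesis .
  qed
  have "integrable lam (\<lambda>x. exp (\<theta> \<bullet> x + e * norm x))"
  proof (rule Bochner_Integration.integrable_bound[OF int])
    show "AE x in lam. norm (exp (\<theta> \<bullet> x + e * norm x)) \<le> norm (?s x)"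
    proof (rule AE_I2)
      fix x
      show "norm (exp (\<theta> \<bullet> x + e * norm x)) \<le> norm (?s x)"
        unfolding real_norm_def abs_exp_cancel by (rule order_trans[OF le abs_ge_self])
    qed
  qed measurable
  with e that show ?thesis by blast
qed

text \<open>In a small ball around \<open>\<theta>\<close>, the tilted function is dominated by a multiple of
  \<open>exp (\<theta> \<bullet> x + e * norm x)\<close>. One half of \<open>e\<close> absorbs the displacement of the parameter, the other half
  absorbs the linear growth of \<open>g\<close>. The cases \<open>g = 1\<close> and \<open>g = id\<close> give the Laplace transform and the
  unnormalised mean.\<close>

lemma
  fixes g :: "'a \<Rightarrow> 'b::{banach, second_countable_topology}"
  assumes \<theta>: "\<theta> \<in> \<Theta>0" and [measurable]: "g \<in> borel_measurable borel"
    and g: "\<And>x. norm (g x) \<le> 1 + norm x"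
  shows integrable_exp_moment: "integrable lam (\<lambda>x. exp (\<theta> \<bullet> x) *\<^sub>R g x)"
    and isCont_exp_moment: "isCont (\<lambda>\<theta>. \<integral>x. exp (\<theta> \<bullet> x) *\<^sub>R g x \<partial>lam) \<theta>"
proof -
  obtain e where e: "e > 0" and int: "integrable lam (\<lambda>x. exp (\<theta> \<bullet> x + e * norm x))"
    using integrable_exp_norm[OF \<theta>] .
  define w where "w x = (1 + 2 / e) * exp (\<theta> \<bullet> x + e * norm x)" for x
  have w: "integrable lam w" unfolding w_def using int by simp
  have bound: "norm (exp (\<eta> \<bullet> x) *\<^sub>R g x) \<le> w x" if "dist \<eta> \<theta> < e / 2" for \<eta> x
  proof -
    have "(\<eta> - \<theta>) \<bullet> x \<le> norm (\<eta> - \<theta>) * norm x" by (rule norm_cauchy_schwarz)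
    also have "\<dots> \<le> (e / 2) * norm x"
      using that by (intro mult_right_mono) (auto simp: dist_norm)
    finally have 1: "exp (\<eta> \<bullet> x) \<le> exp (\<theta> \<bullet> x + (e/2) * norm x)"
      by (simp add: inner_diff_left)
    have "1 + norm x \<le> (1 + 2 / e) * (1 + (e / 2) * norm x)"
      using e by (simp add: field_simps)
    also have "\<dots> \<le> (1 + 2 / e) * exp ((e / 2) * norm x)"
      using e by (intro mult_left_mono exp_ge_add_one_self) auto
    finally have 2: "norm (g x) \<le> (1 + 2 / e) * exp ((e / 2) * norm x)"
      using g[of x] by linarith
    have "norm (exp (\<eta> \<bullet> x) *\<^sub>R g x) = exp (\<eta> \<bullet> x) * norm (g x)" by simp
    also have "\<dots> \<le> exp (\<theta> \<bullet> x + (e/2) * norm x) * ((1 + 2 / e) * exp ((e / 2) * norm x))"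
      using 1 2 by (intro mult_mono) auto
    also have "\<dots> = w x"
      by (simp add: w_def mult_exp_exp algebra_simps)
    finally show ?thesis .
  qed
  have w0: "0 \<le> w x" for x using e by (simp add: w_def)
  show "integrable lam (\<lambda>x. exp (\<theta> \<bullet> x) *\<^sub>R g x)"
    using bound[of \<theta>] e w0 by (intro Bochner_Integration.integrable_bound[OF w]) (auto intro!: AE_I2)
  show "isCont (\<lambda>\<theta>. \<integral>x. exp (\<theta> \<bullet> x) *\<^sub>R g x \<partial>lam) \<theta>"
    unfolding continuous_at_sequentially
  proof (intro allI impI)
    fix s :: "nat \<Rightarrow> 'a" assume s: "s \<longlonglongrightarrow> \<theta>"
    then have "\<forall>\<^sub>F n in sequentially. dist (s n) \<theta> < e / 2"
      using e by (intro tendstoD) auto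
    then obtain N where N: "\<And>n. n \<ge> N \<Longrightarrow> dist (s n) \<theta> < e / 2"
      by (auto simp: eventually_sequentially)
    have "(\<lambda>n. \<integral>x. exp (s (n + N) \<bullet> x) *\<^sub>R g x \<partial>lam) \<longlonglongrightarrow> (\<integral>x. exp (\<theta> \<bullet> x) *\<^sub>R g x \<partial>lam)"
    proof (rule integral_dominated_convergence[where w = w])
      show "AE x in lam. (\<lambda>n. exp (s (n + N) \<bullet> x) *\<^sub>R g x) \<longlonglongrightarrow> exp (\<theta> \<bullet> x) *\<^sub>R g x"
        using LIMSEQ_ignore_initial_segment[OF s] by (intro AE_I2 tendsto_intros)
    qed (use w bound N in auto)
    then show "((\<lambda>\<theta>. \<integral>x. exp (\<theta> \<bullet> x) *\<^sub>R g x \<partial>lam) \<circ> s) \<longlonglongrightarrow> (\<integral>x. exp (\<theta> \<bullet> x) *\<^sub>R g x \<partial>lam)"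
      unfolding comp_def by (rule LIMSEQ_offset)
  qed
qed

section \<open>The cumulant generating function: strict convexity and gradient\<close>

text \<open>The mean of the member of the family with parameter \<open>\<theta>\<close>; \<open>grad_cgf\<close> below shows that it is the
  gradient of \<open>\<kappa>\<close>.\<close>

definition mean :: "'a \<Rightarrow> 'a" where
  "mean \<theta> = (\<integral>x. exp (\<theta> \<bullet> x) *\<^sub>R x \<partial>lam) /\<^sub>R exp (\<kappa> \<theta>)"

lemma integrable_exp_scaleR: "\<theta> \<in> \<Theta>0 \<Longrightarrow> integrable lam (\<lambda>x. exp (\<theta> \<bullet> x) *\<^sub>R x)"
  by (rule integrable_exp_moment) auto

lemma isCont_cgf: assumes "\<theta> \<in> \<Theta>0" shows "isCont \<kappa> \<theta>"
proof -
  have "isCont (\<lambda>\<theta>. \<integral>x. exp (\<theta> \<bullet> x) *\<^sub>R (1::real) \<partial>lam) \<theta>"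
    using assms by (rule isCont_exp_moment) auto
  then have "isCont (\<lambda>\<theta>. ln (\<integral>x. exp (\<theta> \<bullet> x) \<partial>lam)) \<theta>"
    using laplace_eq[OF assms] by (intro isCont_ln') auto
  moreover have "\<forall>\<^sub>F \<eta> in nhds \<theta>. ln (\<integral>x. exp (\<eta> \<bullet> x) \<partial>lam) = \<kappa> \<eta>"
    using eventually_nhds_in_open[OF open_domain assms] by eventually_elim (simp add: laplace_eq)
  ultimately show ?thesis by (simp add: isCont_cong)
qed

lemma isCont_mean: "\<theta> \<in> \<Theta>0 \<Longrightarrow> isCont mean \<theta>"
  unfolding mean_def
  by (intro continuous_intros isCont_exp_moment isCont_cgf) auto

lemma
  assumes \<theta>1: "\<theta>1 \<in> \<Theta>0"
  shows integrable_tilted_inner: "integrable lam (\<lambda>x. exp (\<theta>1 \<bullet> x - \<kappa> \<theta>1) * (v \<bullet> x))"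
    and integral_tilted_inner: "(\<integral>x. exp (\<theta>1 \<bullet> x - \<kappa> \<theta>1) * (v \<bullet> x) \<partial>lam) = v \<bullet> mean \<theta>1"
proof -
  have i: "integrable lam (\<lambda>x. exp (\<theta>1 \<bullet> x) * (v \<bullet> x))"
    using integrable_inner_right[OF integrable_exp_scaleR[OF \<theta>1], of v] by simp
  have eq: "exp (\<theta>1 \<bullet> x - \<kappa> \<theta>1) * (v \<bullet> x) = exp (\<theta>1 \<bullet> x) * (v \<bullet> x) / exp (\<kappa> \<theta>1)" for x
    by (simp add: exp_diff)
  show "integrable lam (\<lambda>x. exp (\<theta>1 \<bullet> x - \<kappa> \<theta>1) * (v \<bullet> x))"
    unfolding eq using i by simp
  have "(\<integral>x. exp (\<theta>1 \<bullet> x) * (v \<bullet> x) \<partial>lam) = v \<bullet> (\<integral>x. exp (\<theta>1 \<bullet> x) *\<^sub>R x \<partial>lam)"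
    using integral_inner_right[of v lam "\<lambda>x. exp (\<theta>1 \<bullet> x) *\<^sub>R x"] integrable_exp_scaleR[OF \<theta>1] by simp
  then show "(\<integral>x. exp (\<theta>1 \<bullet> x - \<kappa> \<theta>1) * (v \<bullet> x) \<partial>lam) = v \<bullet> mean \<theta>1"
    unfolding eq mean_def by (simp add: divide_inverse mult.commute)
qed

lemma
  assumes "\<theta> \<in> \<Theta>0"
  shows integrable_exp_shift: "integrable lam (\<lambda>x. exp (\<theta> \<bullet> x - c))"
    and integral_exp_shift: "(\<integral>x. exp (\<theta> \<bullet> x - c) \<partial>lam) = exp (\<kappa> \<theta> - c)"
  using assms natural_domain_iff_integrable[of \<theta>] laplace_eq[of \<theta>] by (simp_all add: exp_diff)

text \<open>Let \<open>X\<close> have the distribution with parameter \<open>\<theta>1\<close>, and put \<open>u = (\<theta> - \<theta>1) \<bullet> (X - mean \<theta>1)\<close>. The gap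
  between the two sides is \<open>ln (E (exp u))\<close>. Since \<open>exp u \<ge> 1 + u\<close> and \<open>E u = 0\<close>, it is nonnegative, and it
  vanishes only if \<open>u = 0\<close> almost surely. That would concentrate the measure on a hyperplane.\<close>

lemma cgf_gt_tangent:
  assumes \<theta>1: "\<theta>1 \<in> \<Theta>0" and \<theta>: "\<theta> \<in> \<Theta>0" and ne: "\<theta> \<noteq> \<theta>1"
  shows "\<kappa> \<theta>1 + (\<theta> - \<theta>1) \<bullet> mean \<theta>1 < \<kappa> \<theta>"
proof (rule ccontr)
  define v where "v = \<theta> - \<theta>1"
  define c where "c = v \<bullet> mean \<theta>1"
  define p where "p x = exp (\<theta>1 \<bullet> x - \<kappa> \<theta>1)" for x
  define gap where "gap x = exp (v \<bullet> x - c) - (1 + (v \<bullet> x - c))" for x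
  assume "\<not> ?thesis"
  then have le: "\<kappa> \<theta> - (\<kappa> \<theta>1 + c) \<le> 0" by (simp add: c_def v_def)
  have gap0: "0 \<le> p x * gap x" for x
    unfolding gap_def p_def by (intro mult_nonneg_nonneg) (auto simp: exp_ge_add_one_self)
  have split: "p x * gap x =
      exp (\<theta> \<bullet> x - (\<kappa> \<theta>1 + c)) - ((1 - c) * exp (\<theta>1 \<bullet> x - \<kappa> \<theta>1) + exp (\<theta>1 \<bullet> x - \<kappa> \<theta>1) * (v \<bullet> x))" for x
    by (simp add: p_def gap_def v_def algebra_simps mult_exp_exp)
  have int: "integrable lam (\<lambda>x. p x * gap x)"
    unfolding split using \<theta> \<theta>1
    by (intro Bochner_Integration.integrable_diff Bochner_Integration.integrable_add integrable_exp_shift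
        integrable_tilted_inner integrable_mult_right)
  have "(\<integral>x. p x * gap x \<partial>lam) = exp (\<kappa> \<theta> - (\<kappa> \<theta>1 + c)) - 1"
    unfolding split using integrable_exp_shift[OF \<theta>] integrable_exp_shift[OF \<theta>1]
      integrable_tilted_inner[OF \<theta>1]
    by (simp add: integral_exp_shift[OF \<theta>] integral_exp_shift[OF \<theta>1]
        integral_tilted_inner[OF \<theta>1] c_def)
  also have "\<dots> \<le> 0" using le by simp
  finally have "(\<integral>x. p x * gap x \<partial>lam) = 0"
    using gap0 by (simp add: antisym integral_nonneg)
  then have "AE x in lam. p x * gap x = 0"
    using integral_nonneg_eq_0_iff_AE[OF int] gap0 by simp
  then have ae: "AE x in lam. v \<bullet> x = c"
  proof eventually_elim
    case (elim x)
    then have "exp (v \<bullet> x - c) = 1 + (v \<bullet> x - c)" by (simp add: p_def gap_def)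
    then have "ln (exp (v \<bullet> x - c)) = exp (v \<bullet> x - c) - 1" unfolding ln_exp by linarith
    then have "exp (v \<bullet> x - c) = 1" by (intro ln_eq_minus_one) auto
    then show ?case by simp
  qed
  define H where "H = {x. v \<bullet> x = c}"
  have H: "affine H" unfolding H_def by (rule affine_hyperplane)
  have "v \<noteq> 0" using ne by (simp add: v_def)
  have "H \<noteq> UNIV"
  proof
    assume "H = UNIV"
    then have "v \<bullet> x = c" for x by (auto simp: H_def set_eq_iff)
    from this[of 0] this[of v] \<open>v \<noteq> 0\<close> show False by simp
  qed
  with H have "emeasure lam (UNIV - H) \<noteq> 0"
    using not_affine unfolding not_affinely_concentrated_def by blast
  moreover have "emeasure lam (UNIV - H) = 0"
  proof (subst AE_iff_measurable[symmetric])
    show "UNIV - H \<in> sets lam"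
      unfolding H_def sets_lam by (intro sets.Diff closed_hyperplane borel_closed) auto
    show "{x \<in> space lam. \<not> v \<bullet> x = c} = UNIV - H" by (auto simp: H_def)
    show "AE x in lam. v \<bullet> x = c" by fact
  qed
  ultimately show False by simp
qed

lemma cgf_ge_tangent:
  assumes "\<theta>1 \<in> \<Theta>0" "\<theta> \<in> \<Theta>0"
  shows "\<kappa> \<theta>1 + (\<theta> - \<theta>1) \<bullet> mean \<theta>1 \<le> \<kappa> \<theta>"
  using cgf_gt_tangent[OF assms] by (cases "\<theta> = \<theta>1") auto

text \<open>Using the tangent inequality at both \<open>\<theta>\<close> and \<open>y\<close> squeezes the error of the first-order
  approximation between \<open>0\<close> and \<open>(y - \<theta>) \<bullet> (mean y - mean \<theta>)\<close>, and the mean is continuous.\<close>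

lemma GDERIV_cgf:
  assumes \<theta>: "\<theta> \<in> \<Theta>0"
  shows "GDERIV \<kappa> \<theta> :> mean \<theta>"
  unfolding gderiv_def has_derivative_iff_norm
proof (intro conjI bounded_linear_inner_left)
  let ?q = "\<lambda>y. norm (\<kappa> y - \<kappa> \<theta> - (y - \<theta>) \<bullet> mean \<theta>) / norm (y - \<theta>)"
  have near: "\<forall>\<^sub>F y in at \<theta>. ?q y \<le> norm (mean y - mean \<theta>)"
  proof -
    have "\<forall>\<^sub>F y in at \<theta>. y \<in> \<Theta>0"
      using eventually_nhds_in_open[OF open_domain \<theta>] by (auto simp: eventually_at_filter elim: eventually_mono)
    then show ?thesis
    proof eventually_elim
      case (elim y)
      have "0 \<le> \<kappa> y - \<kappa> \<theta> - (y - \<theta>) \<bullet> mean \<theta>"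
        using cgf_ge_tangent[OF \<theta> elim] by simp
      moreover have "\<kappa> y - \<kappa> \<theta> - (y - \<theta>) \<bullet> mean \<theta> \<le> (y - \<theta>) \<bullet> (mean y - mean \<theta>)"
        using cgf_ge_tangent[OF elim \<theta>] by (simp add: inner_diff_left inner_diff_right)
      moreover have "(y - \<theta>) \<bullet> (mean y - mean \<theta>) \<le> norm (y - \<theta>) * norm (mean y - mean \<theta>)"
        by (rule norm_cauchy_schwarz)
      ultimately show ?case
        by (cases "y = \<theta>") (auto simp: divide_le_eq mult.commute)
    qed
  qed
  have "((\<lambda>y. norm (mean y - mean \<theta>)) \<longlongrightarrow> norm (mean \<theta> - mean \<theta>)) (at \<theta>)"
    using isCont_mean[OF \<theta>] unfolding isCont_def by (intro tendsto_intros)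
  then have lim: "((\<lambda>y. norm (mean y - mean \<theta>)) \<longlongrightarrow> 0) (at \<theta>)" by simp
  show "(?q \<longlongrightarrow> 0) (at \<theta>)"
    using near by (intro tendsto_sandwich[OF _ _ tendsto_const lim]) auto
qed

lemma grad_cgf: "\<theta> \<in> \<Theta>0 \<Longrightarrow> grad \<kappa> \<theta> = mean \<theta>"
  unfolding grad_def
proof (rule the_equality)
  fix g assume \<theta>: "\<theta> \<in> \<Theta>0" and g: "GDERIV \<kappa> \<theta> :> g"
  have "(\<lambda>h. h \<bullet> g) = (\<lambda>h. h \<bullet> mean \<theta>)"
    using has_derivative_unique GDERIV_cgf[OF \<theta>] g unfolding gderiv_def by blast
  then have "h \<bullet> g = h \<bullet> mean \<theta>" for h by meson
  then show "g = mean \<theta>" by (metis vector_eq_ldot)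
qed (rule GDERIV_cgf)

lemma mean_domain_eq: "mean_domain lam = mean ` \<Theta>0"
  unfolding mean_domain_def by (simp add: grad_cgf cong: image_cong)

lemma kl_eq_Bregman:
  assumes \<theta>1: "\<theta>1 \<in> \<Theta>0" and \<theta>2: "\<theta>2 \<in> \<Theta>0"
  shows "kl lam \<theta>1 \<theta>2 = \<kappa> \<theta>2 - \<kappa> \<theta>1 - (\<theta>2 - \<theta>1) \<bullet> mean \<theta>1"
proof -
  interpret sigma_finite_measure lam by (rule sigma_finite_lam)
  have "kl lam \<theta>1 \<theta>2 = (\<integral>x. exp (\<theta>1 \<bullet> x - \<kappa> \<theta>1) *
      log (exp 1) (exp (\<theta>1 \<bullet> x - \<kappa> \<theta>1) / exp (\<theta>2 \<bullet> x - \<kappa> \<theta>2)) \<partial>lam)"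
    unfolding kl_def nef_def by (rule KL_density_density) auto
  also have "\<dots> = (\<integral>x. (\<kappa> \<theta>2 - \<kappa> \<theta>1) * exp (\<theta>1 \<bullet> x - \<kappa> \<theta>1)
      + exp (\<theta>1 \<bullet> x - \<kappa> \<theta>1) * ((\<theta>1 - \<theta>2) \<bullet> x) \<partial>lam)"
  proof (rule Bochner_Integration.integral_cong[OF refl])
    fix x
    have "log (exp 1) (exp (\<theta>1 \<bullet> x - \<kappa> \<theta>1) / exp (\<theta>2 \<bullet> x - \<kappa> \<theta>2)) =
        (\<theta>1 \<bullet> x - \<kappa> \<theta>1) - (\<theta>2 \<bullet> x - \<kappa> \<theta>2)"
      by (simp only: exp_diff[symmetric] log_ln[symmetric] ln_exp)
    then show "exp (\<theta>1 \<bullet> x - \<kappa> \<theta>1) *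
        log (exp 1) (exp (\<theta>1 \<bullet> x - \<kappa> \<theta>1) / exp (\<theta>2 \<bullet> x - \<kappa> \<theta>2)) =
        (\<kappa> \<theta>2 - \<kappa> \<theta>1) * exp (\<theta>1 \<bullet> x - \<kappa> \<theta>1) + exp (\<theta>1 \<bullet> x - \<kappa> \<theta>1) * ((\<theta>1 - \<theta>2) \<bullet> x)"
      by (simp only:) (simp add: inner_diff_left algebra_simps)
  qed
  also have "\<dots> = (\<kappa> \<theta>2 - \<kappa> \<theta>1) + (\<theta>1 - \<theta>2) \<bullet> mean \<theta>1"
    using \<theta>1 by (subst Bochner_Integration.integral_add)
      (auto intro!: integrable_mult_right integrable_exp_shift integrable_tilted_inner
        simp: integral_exp_shift integral_tilted_inner)
  finally show ?thesis by (simp add: inner_diff_left)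
qed

lemma kl_diff_eq:
  assumes "\<theta>0 \<in> \<Theta>0" "\<theta> \<in> \<Theta>0" "\<theta>' \<in> \<Theta>0"
  shows "kl lam \<theta>0 \<theta> - kl lam \<theta>0 \<theta>' =
    log_likelihood lam \<theta>' (mean \<theta>0) - log_likelihood lam \<theta> (mean \<theta>0)"
  using assms by (simp add: kl_eq_Bregman log_likelihood_def inner_diff_left)

section \<open>The mean domain and coercivity\<close>

text \<open>Let \<open>t0 = mean \<theta>1\<close>. By the strict tangent inequality, \<open>\<theta> \<mapsto> \<kappa> \<theta> - \<theta> \<bullet> t0\<close> is larger on a small sphere
  around \<open>\<theta>1\<close> than at \<open>\<theta>1\<close>, by some \<open>c > 0\<close>. This survives a small change of \<open>t0\<close> to \<open>t\<close>, so the minimum over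
  the closed ball is attained in its interior, and there the gradient \<open>mean m - t\<close> vanishes.\<close>

lemma open_mean_domain: "open (mean_domain lam)"
  unfolding mean_domain_eq
proof (rule openI, elim imageE)
  fix t0 \<theta>1 assume \<theta>1: "\<theta>1 \<in> \<Theta>0" and t0: "t0 = mean \<theta>1"
  obtain r where r: "r > 0" "cball \<theta>1 r \<subseteq> \<Theta>0"
    using open_domain \<theta>1 open_contains_cball by blast
  have cont: "continuous_on S (\<lambda>\<theta>. \<kappa> \<theta> - \<theta> \<bullet> t)" if "S \<subseteq> cball \<theta>1 r" for S t
    using that r by (intro continuous_intros continuous_at_imp_continuous_on) (auto intro!: isCont_cgf)
  have "sphere \<theta>1 r \<noteq> {}" using r by simp
  then obtain \<eta> where \<eta>: "\<eta> \<in> sphere \<theta>1 r"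
    and min: "\<And>\<theta>. \<theta> \<in> sphere \<theta>1 r \<Longrightarrow> \<kappa> \<eta> - \<eta> \<bullet> t0 \<le> \<kappa> \<theta> - \<theta> \<bullet> t0"
    using continuous_attains_inf[OF compact_sphere _ cont[of "sphere \<theta>1 r" t0]] sphere_cball by blast
  define c where "c = \<kappa> \<eta> - \<eta> \<bullet> t0 - (\<kappa> \<theta>1 - \<theta>1 \<bullet> t0)"
  have "\<eta> \<in> \<Theta>0" "\<eta> \<noteq> \<theta>1" using \<eta> r by auto
  then have c: "c > 0"
    using cgf_gt_tangent[OF \<theta>1, of \<eta>] by (simp add: c_def t0 inner_diff_left)
  show "\<exists>e>0. ball t0 e \<subseteq> mean ` \<Theta>0"
  proof (rule exI[of _ "c / r"], intro conjI subsetI)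
    fix t assume "t \<in> ball t0 (c / r)"
    then have t: "r * norm (t - t0) < c"
      using r by (simp add: dist_norm norm_minus_commute field_simps)
    let ?g = "\<lambda>\<theta>. \<kappa> \<theta> - \<theta> \<bullet> t"
    have boundary: "?g \<theta>1 < ?g \<theta>" if "\<theta> \<in> sphere \<theta>1 r" for \<theta>
    proof -
      have "(\<theta> - \<theta>1) \<bullet> (t - t0) \<le> norm (\<theta> - \<theta>1) * norm (t - t0)" by (rule norm_cauchy_schwarz)
      also have "\<dots> = r * norm (t - t0)" using that by (simp add: dist_norm norm_minus_commute)
      also have "\<dots> < c" by fact
      finally show ?thesis
        using min[OF that] by (simp add: c_def inner_diff_left inner_diff_right)
    qed
    obtain m where m: "m \<in> cball \<theta>1 r" and gm: "\<And>\<theta>. \<theta> \<in> cball \<theta>1 r \<Longrightarrow> ?g m \<le> ?g \<theta>"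
      using continuous_attains_inf[OF compact_cball _ cont[of "cball \<theta>1 r" t]] r by fastforce
    have "m \<notin> sphere \<theta>1 r"
      using boundary[of m] gm[of \<theta>1] r by force
    with m have mb: "m \<in> ball \<theta>1 r" by auto
    have m0: "m \<in> \<Theta>0" using m r by blast
    have "(?g has_derivative (\<lambda>h. h \<bullet> mean m - h \<bullet> t)) (at m)"
      using GDERIV_cgf[OF m0] unfolding gderiv_def by (intro derivative_intros)
    then have "(\<lambda>h. h \<bullet> mean m - h \<bullet> t) = (\<lambda>h. 0)"
      using mb gm by (intro differential_zero_maxmin[of m "ball \<theta>1 r" ?g]) auto
    then have "h \<bullet> mean m - h \<bullet> t = 0" for h by meson
    then have "mean m = t" by (metis eq_iff_diff_eq_0 vector_eq_ldot)
    with m0 show "t \<in> mean ` \<Theta>0" by blast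
  qed (use c r in auto)
qed

lemma cgf_minus_linear_bounded_below:
  assumes "t \<in> mean_domain lam"
  shows "\<exists>c. \<forall>\<theta>\<in>\<Theta>0. c \<le> \<kappa> \<theta> - \<theta> \<bullet> t"
proof -
  obtain \<theta>1 where "\<theta>1 \<in> \<Theta>0" "t = mean \<theta>1" using assms by (auto simp: mean_domain_eq)
  then have "\<forall>\<theta>\<in>\<Theta>0. \<kappa> \<theta>1 - \<theta>1 \<bullet> t \<le> \<kappa> \<theta> - \<theta> \<bullet> t"
    using cgf_ge_tangent by (force simp: inner_diff_left)
  then show ?thesis by blast
qed

text \<open>The affine lower bounds of \<open>\<kappa>\<close> with slopes \<open>t + r *\<^sub>R b\<close> and \<open>t - r *\<^sub>R b\<close> make \<open>\<kappa> \<theta> - \<theta> \<bullet> t\<close> grow at least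
  like \<open>r * \<bar>\<theta> \<bullet> b\<bar>\<close>, for each basis vector \<open>b\<close>. Averaging over the basis gives growth in the norm.\<close>

lemma cgf_coercive:
  assumes t: "t \<in> mean_domain lam"
  obtains e C where "e > 0" "\<And>\<theta>. \<theta> \<in> \<Theta>0 \<Longrightarrow> e * norm \<theta> - C \<le> \<kappa> \<theta> - \<theta> \<bullet> t"
proof -
  obtain r where r: "r > 0" "cball t r \<subseteq> mean_domain lam"
    using open_mean_domain t open_contains_cball by blast
  obtain c where c: "\<And>s \<theta>. s \<in> mean_domain lam \<Longrightarrow> \<theta> \<in> \<Theta>0 \<Longrightarrow> c s \<le> \<kappa> \<theta> - \<theta> \<bullet> s"
    using cgf_minus_linear_bounded_below by metis
  define K where "K = (\<Sum>b\<in>Basis. \<bar>c (t + r *\<^sub>R b)\<bar> + \<bar>c (t - r *\<^sub>R b)\<bar>)"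
  have coord: "r * \<bar>\<theta> \<bullet> b\<bar> - K \<le> \<kappa> \<theta> - \<theta> \<bullet> t" if \<theta>: "\<theta> \<in> \<Theta>0" and b: "b \<in> Basis" for \<theta> b
  proof -
    have "t + r *\<^sub>R b \<in> mean_domain lam" "t - r *\<^sub>R b \<in> mean_domain lam"
      using r b by (auto simp: dist_norm intro!: subsetD[OF r(2)])
    from this[THEN c, OF \<theta>]
    have 1: "c (t + r *\<^sub>R b) + r * (\<theta> \<bullet> b) \<le> \<kappa> \<theta> - \<theta> \<bullet> t" "c (t - r *\<^sub>R b) - r * (\<theta> \<bullet> b) \<le> \<kappa> \<theta> - \<theta> \<bullet> t"
      by (simp_all add: inner_add_right inner_diff_right)
    have "\<bar>c (t + r *\<^sub>R b)\<bar> + \<bar>c (t - r *\<^sub>R b)\<bar> \<le> K"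
      unfolding K_def using b by (intro member_le_sum[where f = "\<lambda>b. \<bar>c (t + r *\<^sub>R b)\<bar> + \<bar>c (t - r *\<^sub>R b)\<bar>"]) auto
    with 1 show ?thesis by (cases "\<theta> \<bullet> b \<ge> 0") auto
  qed
  have "r / DIM('a) * norm \<theta> - K \<le> \<kappa> \<theta> - \<theta> \<bullet> t" if \<theta>: "\<theta> \<in> \<Theta>0" for \<theta>
  proof -
    have "r * norm \<theta> \<le> r * (\<Sum>b\<in>Basis. \<bar>\<theta> \<bullet> b\<bar>)"
      using r by (intro mult_left_mono norm_le_l1) auto
    also have "\<dots> = (\<Sum>b\<in>Basis. r * \<bar>\<theta> \<bullet> b\<bar>)" by (rule sum_distrib_left)
    also have "\<dots> \<le> (\<Sum>b\<in>(Basis :: 'a set). \<kappa> \<theta> - \<theta> \<bullet> t + K)"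
      using coord[OF \<theta>] by (intro sum_mono) (simp add: diff_le_eq)
    also have "\<dots> = DIM('a) * (\<kappa> \<theta> - \<theta> \<bullet> t + K)" by simp
    finally show ?thesis by (simp add: field_simps)
  qed
  moreover have "r / DIM('a) > 0" using r by simp
  ultimately show ?thesis using that by blast
qed

text \<open>The set is closed in the whole space, not just in the natural domain: along a convergent
  sequence in it the Laplace transform stays bounded, so by Fatou's lemma it is finite at the limit.\<close>

lemma compact_sublevel:
  assumes t: "t \<in> mean_domain lam"
  shows "compact {\<theta> \<in> \<Theta>0. \<kappa> \<theta> - \<theta> \<bullet> t \<le> c}"
  unfolding compact_eq_bounded_closed
proof
  obtain e C where e: "e > 0" and coercive: "\<And>\<theta>. \<theta> \<in> \<Theta>0 \<Longrightarrow> e * norm \<theta> - C \<le> \<kappa> \<theta> - \<theta> \<bullet> t"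
    using cgf_coercive[OF t] by blast
  show "bounded {\<theta> \<in> \<Theta>0. \<kappa> \<theta> - \<theta> \<bullet> t \<le> c}"
  proof (rule boundedI)
    fix \<theta> assume "\<theta> \<in> {\<theta> \<in> \<Theta>0. \<kappa> \<theta> - \<theta> \<bullet> t \<le> c}"
    then show "norm \<theta> \<le> (c + C) / e" using coercive[of \<theta>] e by (simp add: field_simps)
  qed
  show "closed {\<theta> \<in> \<Theta>0. \<kappa> \<theta> - \<theta> \<bullet> t \<le> c}"
    unfolding closed_sequential_limits
  proof (intro allI impI, elim conjE)
    fix s :: "nat \<Rightarrow> 'a" and l
    assume s: "\<forall>n. s n \<in> {\<theta> \<in> \<Theta>0. \<kappa> \<theta> - \<theta> \<bullet> t \<le> c}" and lim: "s \<longlonglongrightarrow> l"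
    have "(\<integral>\<^sup>+x. ennreal (exp (l \<bullet> x)) \<partial>lam) = (\<integral>\<^sup>+x. liminf (\<lambda>n. ennreal (exp (s n \<bullet> x))) \<partial>lam)"
      using lim by (intro nn_integral_cong lim_imp_Liminf[symmetric] tendsto_intros) auto
    also have "\<dots> \<le> liminf (\<lambda>n. \<integral>\<^sup>+x. ennreal (exp (s n \<bullet> x)) \<partial>lam)"
      by (rule nn_integral_liminf) simp
    also have "\<dots> \<le> liminf (\<lambda>n. ennreal (exp (c + s n \<bullet> t)))"
      using s by (intro Liminf_mono always_eventually allI) (auto simp: nn_laplace_eq algebra_simps)
    also have "\<dots> = ennreal (exp (c + l \<bullet> t))"
      using lim by (intro lim_imp_Liminf tendsto_intros) auto
    also have "\<dots> < \<infinity>" by simp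
    finally have l: "l \<in> \<Theta>0" unfolding natural_domain_iff .
    then have "(\<lambda>n. \<kappa> (s n)) \<longlonglongrightarrow> \<kappa> l"
      using isCont_tendsto_compose[OF isCont_cgf lim] by blast
    then have "(\<lambda>n. \<kappa> (s n) - s n \<bullet> t) \<longlonglongrightarrow> \<kappa> l - l \<bullet> t"
      using lim by (intro tendsto_intros)
    then have "\<kappa> l - l \<bullet> t \<le> c"
      using s by (intro LIMSEQ_le_const2) auto
    with l show "l \<in> {\<theta> \<in> \<Theta>0. \<kappa> \<theta> - \<theta> \<bullet> t \<le> c}" by simp
  qed
qed

end

section \<open>The posterior and its exponential rates\<close>

locale exponential_family_prior = regular_exponential_family lam + prior: prob_space \<nu>
  for lam \<nu> :: "'a::euclidean_space measure" +
  assumes sets_prior: "sets \<nu> = sets (restrict_space borel (natural_domain lam))"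
begin

abbreviation \<Theta> :: "'a set" where "\<Theta> \<equiv> support_in (top_of_set \<Theta>0) \<nu>"

definition likelihood_mass :: "'a \<Rightarrow> nat \<Rightarrow> 'a set \<Rightarrow> ennreal" where
  "likelihood_mass t n A = (\<integral>\<^sup>+\<theta>\<in>A. ennreal (exp (real n * log_likelihood lam \<theta> t)) \<partial>\<nu>)"

lemma space_prior: "space \<nu> = \<Theta>0"
  using sets_eq_imp_space_eq[OF sets_prior] by (simp add: space_restrict_space)

lemma support_subset: "\<Theta> \<subseteq> \<Theta>0"
  by (auto simp: support_in_def)

lemma borel_domain: "\<Theta>0 \<in> sets borel"
  using open_domain by simp

lemma borel_support: "\<Theta> \<in> sets borel"
proof -
  obtain T where "closed T" "\<Theta> = T \<inter> \<Theta>0"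
    using closedin_support_in[OF sets_prior] unfolding closedin_closed by auto
  then show ?thesis using borel_domain by auto
qed

lemma sets_prior_iff: "A \<in> sets \<nu> \<longleftrightarrow> A \<in> sets borel \<and> A \<subseteq> \<Theta>0"
  unfolding sets_prior using borel_domain by (auto simp: sets_restrict_space_iff)

lemma borel_sets_of_support: "A \<in> borel_sets_of (top_of_set \<Theta>) \<longleftrightarrow> A \<in> sets borel \<and> A \<subseteq> \<Theta>"
  unfolding borel_sets_of_top_of_set[OF borel_support] using borel_support
  by (auto simp: sets_restrict_space_iff)

lemma emeasure_prior_support: "emeasure \<nu> \<Theta> = 1"
proof -
  have "\<Theta> \<in> sets \<nu>" using borel_support support_subset sets_prior_iff by blast
  then have "AE \<theta> in \<nu>. \<theta> \<in> \<Theta>"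
    using emeasure_off_support_in[OF sets_prior]
    by (subst AE_iff_measurable[of "\<Theta>0 - \<Theta>"]) (auto simp: space_prior intro!: sets.compl_sets[of _ \<nu>, unfolded space_prior])
  then show ?thesis using prior.emeasure_eq_1_AE \<open>\<Theta> \<in> sets \<nu>\<close> by blast
qed

lemma support_nonempty: "\<Theta> \<noteq> {}"
  using emeasure_prior_support by (metis emeasure_empty zero_neq_one)

lemma measurable_likelihood [measurable]:
  "(\<lambda>\<theta>. ennreal (exp (real n * log_likelihood lam \<theta> t))) \<in> borel_measurable \<nu>"
proof -
  have "continuous_on \<Theta>0 \<kappa>"
    using isCont_cgf by (simp add: continuous_at_imp_continuous_on)
  then have "(\<lambda>\<theta>. exp (real n * log_likelihood lam \<theta> t)) \<in> borel_measurable (restrict_space borel \<Theta>0)"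
    unfolding log_likelihood_def
    by (intro borel_measurable_continuous_on_restrict continuous_intros)
  then have "(\<lambda>\<theta>. exp (real n * log_likelihood lam \<theta> t)) \<in> borel_measurable \<nu>"
    unfolding measurable_cong_sets[OF sets_prior refl] .
  then show ?thesis by measurable
qed

lemma likelihood_mass_le:
  assumes "A \<subseteq> \<Theta>0" "\<And>\<theta>. \<theta> \<in> A \<Longrightarrow> log_likelihood lam \<theta> t \<le> c"
  shows "likelihood_mass t n A \<le> ennreal (exp (real n * c))"
proof -
  have "likelihood_mass t n A \<le> (\<integral>\<^sup>+\<theta>. ennreal (exp (real n * c)) \<partial>\<nu>)"
    unfolding likelihood_mass_def using assms
    by (intro nn_integral_mono) (auto simp: indicator_def intro!: ennreal_leI mult_left_mono)
  also have "\<dots> = ennreal (exp (real n * c))"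
    using prior.emeasure_space_1 by simp
  finally show ?thesis .
qed

lemma likelihood_mass_ge:
  assumes "U \<in> sets \<nu>" "U \<subseteq> A" "\<And>\<theta>. \<theta> \<in> U \<Longrightarrow> c \<le> log_likelihood lam \<theta> t"
  shows "ennreal (exp (real n * c)) * emeasure \<nu> U \<le> likelihood_mass t n A"
proof -
  have "ennreal (exp (real n * c)) * emeasure \<nu> U = (\<integral>\<^sup>+\<theta>. ennreal (exp (real n * c)) * indicator U \<theta> \<partial>\<nu>)"
    using assms(1) by (simp add: nn_integral_cmult_indicator)
  also have "\<dots> \<le> likelihood_mass t n A"
    unfolding likelihood_mass_def using assms
    by (intro nn_integral_mono) (auto simp: indicator_def intro!: ennreal_leI mult_left_mono)
  finally show ?thesis .
qed

lemma likelihood_mass_support_finite: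
  assumes "t \<in> mean_domain lam" shows "likelihood_mass t n \<Theta> < \<infinity>"
proof -
  obtain c where "\<forall>\<theta>\<in>\<Theta>0. c \<le> \<kappa> \<theta> - \<theta> \<bullet> t"
    using cgf_minus_linear_bounded_below[OF assms] by blast
  then have "likelihood_mass t n \<Theta> \<le> ennreal (exp (real n * - c))"
    using support_subset by (intro likelihood_mass_le) (force simp: log_likelihood_def)+
  then show ?thesis by (simp add: le_less_trans)
qed

lemma likelihood_mass_support_nonzero: "likelihood_mass t n \<Theta> \<noteq> 0"
proof
  assume "likelihood_mass t n \<Theta> = 0"
  moreover have "\<Theta> \<in> sets \<nu>" using borel_support support_subset sets_prior_iff by blast
  ultimately have "AE \<theta> in \<nu>. \<theta> \<notin> \<Theta>"
    unfolding likelihood_mass_def by (subst (asm) nn_integral_0_iff_AE) (auto simp: indicator_def split: if_splits)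
  then have "emeasure \<nu> \<Theta> = 0"
    using \<open>\<Theta> \<in> sets \<nu>\<close> AE_iff_null_sets by blast
  then show False using emeasure_prior_support by simp
qed

text \<open>The posterior is given by a set function, for which \<open>measure_of\<close> promises nothing by itself. It is
  identified with the restriction to \<open>\<Theta>\<close> of the measure with the normalised likelihood as density with
  respect to the prior, whose measure axioms are known.\<close>

lemma
  assumes t: "t \<in> mean_domain lam"
  shows sets_posterior: "sets (posterior lam \<nu> \<Theta> n t) = borel_sets_of (top_of_set \<Theta>)"
    and space_posterior: "space (posterior lam \<nu> \<Theta> n t) = \<Theta>"
    and emeasure_posterior: "A \<in> borel_sets_of (top_of_set \<Theta>) \<Longrightarrow>
      emeasure (posterior lam \<nu> \<Theta> n t) A = likelihood_mass t n A / likelihood_mass t n \<Theta>"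
    and prob_space_posterior: "prob_space (posterior lam \<nu> \<Theta> n t)"
proof -
  define M where "M = restrict_space (density \<nu>
    (\<lambda>\<theta>. ennreal (exp (real n * log_likelihood lam \<theta> t)) / likelihood_mass t n \<Theta>)) \<Theta>"
  have \<Theta>: "\<Theta> \<in> sets \<nu>" using borel_support support_subset sets_prior_iff by blast
  have space_M: "space M = \<Theta>" using support_subset
    by (auto simp: M_def space_restrict_space space_prior)
  have sets_M: "sets M = borel_sets_of (top_of_set \<Theta>)"
  proof (rule set_eqI)
    fix A
    have "A \<in> sets M \<longleftrightarrow> A \<in> sets \<nu> \<and> A \<subseteq> \<Theta>"
      using \<Theta> unfolding M_def by (subst sets_restrict_space_iff) auto
    then show "A \<in> sets M \<longleftrightarrow> A \<in> borel_sets_of (top_of_set \<Theta>)"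
      using borel_sets_of_support[of A] sets_prior_iff[of A] support_subset by blast
  qed
  have em: "emeasure M A = likelihood_mass t n A / likelihood_mass t n \<Theta>" if "A \<in> borel_sets_of (top_of_set \<Theta>)" for A
  proof -
    have A: "A \<in> sets \<nu>" "A \<subseteq> \<Theta>" using that borel_sets_of_support sets_prior_iff support_subset by auto
    have "emeasure M A = (\<integral>\<^sup>+\<theta>. ennreal (exp (real n * log_likelihood lam \<theta> t)) / likelihood_mass t n \<Theta> * indicator A \<theta> \<partial>\<nu>)"
      using A \<Theta> by (simp add: M_def emeasure_restrict_space emeasure_density)
    also have "\<dots> = (\<integral>\<^sup>+\<theta>. (ennreal (exp (real n * log_likelihood lam \<theta> t)) * indicator A \<theta>) / likelihood_mass t n \<Theta> \<partial>\<nu>)"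
      by (intro nn_integral_cong) (auto simp: indicator_def)
    also have "\<dots> = likelihood_mass t n A / likelihood_mass t n \<Theta>"
      unfolding likelihood_mass_def using A
      by (intro nn_integral_divide borel_measurable_times_ennreal measurable_likelihood borel_measurable_indicator)
    finally show ?thesis .
  qed
  have "posterior lam \<nu> \<Theta> n t = measure_of (space M) (sets M) (emeasure M)"
    unfolding posterior_def space_M sets_M likelihood_mass_def[symmetric]
  proof (rule measure_of_eq)
    show "borel_sets_of (top_of_set \<Theta>) \<subseteq> Pow \<Theta>" using borel_sets_of_support by blast
    fix A assume "A \<in> sigma_sets \<Theta> (borel_sets_of (top_of_set \<Theta>))"
    then have "A \<in> borel_sets_of (top_of_set \<Theta>)"
      using sets.sigma_sets_eq[of M] by (simp add: space_M sets_M)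
    then show "likelihood_mass t n A / likelihood_mass t n \<Theta> = emeasure M A" by (simp add: em)
  qed
  then have eq: "posterior lam \<nu> \<Theta> n t = M" by (simp only: measure_of_of_measure)
  show "sets (posterior lam \<nu> \<Theta> n t) = borel_sets_of (top_of_set \<Theta>)"
    "space (posterior lam \<nu> \<Theta> n t) = \<Theta>"
    unfolding eq by (rule sets_M space_M)+
  show "A \<in> borel_sets_of (top_of_set \<Theta>) \<Longrightarrow>
      emeasure (posterior lam \<nu> \<Theta> n t) A = likelihood_mass t n A / likelihood_mass t n \<Theta>"
    unfolding eq by (rule em)
  show "prob_space (posterior lam \<nu> \<Theta> n t)"
    unfolding eq
  proof
    have "\<Theta> \<in> borel_sets_of (top_of_set \<Theta>)" using borel_support borel_sets_of_support by blast
    then show "emeasure M (space M) = 1"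
      using likelihood_mass_support_nonzero likelihood_mass_support_finite[OF t] by (simp add: space_M em ennreal_divide_self)
  qed
qed

text \<open>The prior has mass one, so a bound on the log-likelihood that is uniform over \<open>A\<close> suffices. Beyond
  the radius \<open>R\<close>, half of the coercivity slope \<open>d\<close> absorbs the perturbation and the other half pushes
  the log-likelihood below \<open>c\<close>; within that radius the perturbation is at most \<open>R * \<delta> \<le> e\<close>.\<close>

lemma eventually_likelihood_mass_le:
  assumes x: "x \<longlonglongrightarrow> t" and t: "t \<in> mean_domain lam" and A: "A \<subseteq> \<Theta>0" and e: "e > 0"
    and c: "\<And>\<theta>. \<theta> \<in> A \<Longrightarrow> log_likelihood lam \<theta> t \<le> c"
  shows "\<forall>\<^sub>F n in sequentially. likelihood_mass (x n) n A \<le> ennreal (exp (real n * (c + e)))"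
proof -
  obtain d C where d: "d > 0" and coercive: "\<And>\<theta>. \<theta> \<in> \<Theta>0 \<Longrightarrow> d * norm \<theta> - C \<le> \<kappa> \<theta> - \<theta> \<bullet> t"
    using cgf_coercive[OF t] by blast
  define R where "R = max 0 (2 * (C - c) / d)"
  have "R \<ge> 0" by (simp add: R_def)
  define \<delta> where "\<delta> = min (d / 2) (e / (R + 1))"
  have \<delta>: "\<delta> > 0" "\<delta> \<le> d / 2" "R * \<delta> \<le> e"
  proof -
    show "\<delta> > 0" using d e \<open>R \<ge> 0\<close> by (auto simp: \<delta>_def)
    show "\<delta> \<le> d / 2" unfolding \<delta>_def by (rule min.cobounded1)
    have "R * \<delta> \<le> R * (e / (R + 1))" using \<open>R \<ge> 0\<close> by (intro mult_left_mono) (auto simp: \<delta>_def)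
    also have "\<dots> \<le> e" using \<open>R \<ge> 0\<close> e by (simp add: field_simps)
    finally show "R * \<delta> \<le> e" .
  qed
  have "\<forall>\<^sub>F n in sequentially. dist (x n) t < \<delta>"
    using x \<delta>(1) by (rule tendstoD)
  then show ?thesis
  proof eventually_elim
    case (elim n)
    have "log_likelihood lam \<theta> (x n) \<le> c + e" if \<theta>: "\<theta> \<in> A" for \<theta>
    proof -
      have "\<theta> \<bullet> (x n - t) \<le> norm \<theta> * norm (x n - t)" by (rule norm_cauchy_schwarz)
      also have "\<dots> \<le> norm \<theta> * \<delta>"
        using elim by (intro mult_left_mono) (auto simp: dist_norm)
      finally have shift: "log_likelihood lam \<theta> (x n) \<le> log_likelihood lam \<theta> t + norm \<theta> * \<delta>"
        by (simp add: log_likelihood_def inner_diff_right)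
      show ?thesis
      proof (cases "norm \<theta> \<le> R")
        case True
        then have "norm \<theta> * \<delta> \<le> R * \<delta>" using \<delta> by (intro mult_right_mono) auto
        then show ?thesis using shift c[OF \<theta>] \<delta> by linarith
      next
        case False
        then have "2 * (C - c) / d < norm \<theta>" by (simp add: R_def)
        then have 1: "C - c < d / 2 * norm \<theta>" using d by (simp add: field_simps)
        have "norm \<theta> * \<delta> \<le> norm \<theta> * (d / 2)" using \<delta> by (intro mult_left_mono) auto
        moreover have "log_likelihood lam \<theta> t \<le> C - d * norm \<theta>"
          using coercive[of \<theta>] \<theta> A by (auto simp: log_likelihood_def)
        ultimately have "log_likelihood lam \<theta> (x n) \<le> C - d / 2 * norm \<theta>"
          using shift by (simp add: field_simps)
        then show ?thesis using 1 e by linarith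
      qed
    qed
    then show ?case using A by (intro likelihood_mass_le)
  qed
qed

text \<open>Only a neighbourhood \<open>V\<close> of \<open>\<theta>1\<close> in the support is used, on which the limiting log-likelihood loses
  at most \<open>e / 2\<close> and the perturbation \<open>\<theta> \<bullet> (x n - t)\<close> another \<open>e / 2\<close>. Its prior mass serves as \<open>p\<close>.\<close>

lemma eventually_likelihood_mass_ge:
  assumes x: "x \<longlonglongrightarrow> t" and e: "e > 0"
    and U: "openin (top_of_set \<Theta>) U" "\<theta>1 \<in> U" "U \<subseteq> A"
  obtains p where "p > 0" "\<forall>\<^sub>F n in sequentially.
    ennreal (p * exp (real n * (log_likelihood lam \<theta>1 t - e))) \<le> likelihood_mass (x n) n A"
proof -
  let ?f = "\<lambda>\<theta>. log_likelihood lam \<theta> t"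
  have \<theta>1: "\<theta>1 \<in> \<Theta>" "\<theta>1 \<in> \<Theta>0" using U support_subset openin_subset by fastforce+
  have "isCont ?f \<theta>1"
    unfolding log_likelihood_def using \<theta>1 by (intro continuous_intros isCont_cgf)
  then obtain d where d: "d > 0" and near: "\<And>\<theta>. dist \<theta> \<theta>1 < d \<Longrightarrow> dist (?f \<theta>) (?f \<theta>1) < e / 2"
    using e unfolding continuous_at_eps_delta by (metis half_gt_zero)
  define V where "V = U \<inter> ball \<theta>1 (min d 1)"
  obtain T where T: "open T" "U = \<Theta> \<inter> T" using U(1) by (auto simp: openin_open)
  define W where "W = \<Theta>0 \<inter> (T \<inter> ball \<theta>1 (min d 1))"
  have W: "openin (top_of_set \<Theta>0) W" unfolding W_def using T(1) by (intro openin_open_Int) auto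
  have V: "V \<in> sets \<nu>"
    using borel_support T support_subset unfolding V_def T(2) sets_prior_iff by auto
  have "emeasure \<nu> V > 0"
  proof -
    have "\<theta>1 \<in> W" using U(2) T(2) \<theta>1 d by (auto simp: W_def)
    then have "0 < emeasure \<nu> W" using W \<theta>1(1) by (auto simp: support_in_def)
    \<comment> \<open>A neighbourhood in \<open>\<Theta>0\<close> of a support point has positive mass by definition; the part outside \<open>\<Theta>\<close> is null.\<close>
    also have "\<dots> \<le> emeasure \<nu> (V \<union> (\<Theta>0 - \<Theta>))"
      using V borel_domain borel_support
      by (intro emeasure_mono) (auto simp: V_def W_def T(2) sets_prior_iff)
    also have "\<dots> \<le> emeasure \<nu> V + emeasure \<nu> (\<Theta>0 - \<Theta>)"
      using V borel_domain borel_support by (intro emeasure_subadditive) (auto simp: sets_prior_iff)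
    finally show ?thesis by (simp add: emeasure_off_support_in[OF sets_prior])
  qed
  then have p: "measure \<nu> V > 0"
    by (simp add: prior.emeasure_eq_measure)
  define r where "r = norm \<theta>1 + 1"
  define \<delta> where "\<delta> = e / 2 / r"
  have "r > 0" by (simp add: r_def add_nonneg_pos)
  then have \<delta>: "\<delta> > 0" "r * \<delta> = e / 2"
    using e by (simp_all add: \<delta>_def)
  have "\<forall>\<^sub>F n in sequentially. dist (x n) t < \<delta>"
    using x \<delta>(1) by (rule tendstoD)
  then have "\<forall>\<^sub>F n in sequentially.
    ennreal (measure \<nu> V * exp (real n * (?f \<theta>1 - e))) \<le> likelihood_mass (x n) n A"
  proof eventually_elim
    case (elim n)
    have "?f \<theta>1 - e \<le> log_likelihood lam \<theta> (x n)" if "\<theta> \<in> V" for \<theta>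
    proof -
      have dd: "dist \<theta> \<theta>1 < d" "dist \<theta> \<theta>1 < 1" using that by (auto simp: V_def dist_commute)
      have nt: "norm \<theta> \<le> r"
        using dd(2) norm_triangle_ineq2[of \<theta> \<theta>1] by (simp add: dist_norm r_def)
      have "\<theta> \<bullet> (t - x n) \<le> norm \<theta> * norm (t - x n)" by (rule norm_cauchy_schwarz)
      also have "\<dots> \<le> r * \<delta>"
        using elim nt \<open>r > 0\<close> by (intro mult_mono) (auto simp: dist_norm norm_minus_commute)
      finally have "\<theta> \<bullet> (t - x n) \<le> e / 2" using \<delta> by simp
      then show ?thesis
        using near[OF dd(1)]
        unfolding log_likelihood_def inner_diff_right dist_real_def abs_less_iff by linarith
    qed
    then have "ennreal (exp (real n * (?f \<theta>1 - e))) * emeasure \<nu> V \<le> likelihood_mass (x n) n A"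
      using U(3) by (intro likelihood_mass_ge V) (auto simp: V_def)
    then show ?case
      by (simp add: prior.emeasure_eq_measure ennreal_mult'' mult.commute)
  qed
  with p that show ?thesis by blast
qed

section \<open>The large deviation principle\<close>

text \<open>One third of \<open>e\<close> is spent on the numerator, one on the denominator, and one on the subexponential
  factor \<open>1 / p\<close>. The same holds for the lower bound.\<close>

lemma eventually_posterior_le:
  assumes x: "x \<longlonglongrightarrow> t" and t: "t \<in> mean_domain lam"
    and A: "A \<in> borel_sets_of (top_of_set \<Theta>)" and \<theta>s: "\<theta>s \<in> \<Theta>" and e: "e > 0"
    and c: "\<And>\<theta>. \<theta> \<in> A \<Longrightarrow> log_likelihood lam \<theta> t \<le> log_likelihood lam \<theta>s t - c"
  shows "\<forall>\<^sub>F n in sequentially.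
    ereal (1 / real n) * ln_ennreal (emeasure (posterior lam \<nu> \<Theta> n (x n)) A) \<le> ereal (e - c)"
proof -
  define S where "S = log_likelihood lam \<theta>s t"
  have A': "A \<subseteq> \<Theta>0" using A borel_sets_of_support support_subset by blast
  have "openin (top_of_set \<Theta>) \<Theta>" by simp
  then obtain p where p: "p > 0" and den: "\<forall>\<^sub>F n in sequentially.
      ennreal (p * exp (real n * (S - e / 3))) \<le> likelihood_mass (x n) n \<Theta>"
    using eventually_likelihood_mass_ge[OF x, of "e / 3" \<Theta> \<theta>s \<Theta>] \<theta>s e unfolding S_def by auto
  have num: "\<forall>\<^sub>F n in sequentially. likelihood_mass (x n) n A \<le> ennreal (exp (real n * (S - c + e / 3)))"
    using eventually_likelihood_mass_le[OF x t A' _ c, of "e / 3"] e unfolding S_def by simp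
  have "\<forall>\<^sub>F n in sequentially. - ln p / (e / 3) \<le> real n"
    by real_asymp
  then have prefactor: "\<forall>\<^sub>F n in sequentially. - ln p \<le> real n * (e / 3)"
    by eventually_elim (use e in \<open>simp add: field_simps\<close>)
  have "\<forall>\<^sub>F n in sequentially. x n \<in> mean_domain lam"
    using x open_mean_domain t by (rule topological_tendstoD)
  then show ?thesis
    using den num prefactor eventually_gt_at_top[of 0]
  proof eventually_elim
    case (elim n)
    let ?N = "exp (real n * (S - c + e / 3))" and ?D = "p * exp (real n * (S - e / 3))"
    have "emeasure (posterior lam \<nu> \<Theta> n (x n)) A = likelihood_mass (x n) n A / likelihood_mass (x n) n \<Theta>"
      using elim A by (intro emeasure_posterior)
    also have "\<dots> \<le> ennreal ?N / ennreal ?D"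
      using elim by (intro divide_mono_ennreal)
    also have "\<dots> = ennreal (?N / ?D)"
      using p by (intro divide_ennreal) auto
    also have "?N / ?D = exp (real n * (S - c + e / 3) - (ln p + real n * (S - e / 3)))"
      using p by (simp only: exp_diff exp_add exp_ln)
    also have "\<dots> \<le> exp (real n * (e - c))"
      using elim(4) by (simp add: algebra_simps)
    finally have "emeasure (posterior lam \<nu> \<Theta> n (x n)) A \<le> ennreal (exp (real n * (e - c)))"
      by (simp add: ennreal_leI)
    then show ?case using elim by (intro scaled_ln_ennreal_le)
  qed
qed

lemma eventually_posterior_ge:
  assumes x: "x \<longlonglongrightarrow> t" and t: "t \<in> mean_domain lam"
    and A: "A \<in> borel_sets_of (top_of_set \<Theta>)" and e: "e > 0"
    and \<theta>1: "\<theta>1 \<in> top_of_set \<Theta> interior_of A"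
    and \<theta>s: "\<And>\<theta>. \<theta> \<in> \<Theta> \<Longrightarrow> log_likelihood lam \<theta> t \<le> log_likelihood lam \<theta>s t"
  shows "\<forall>\<^sub>F n in sequentially.
    ereal (log_likelihood lam \<theta>1 t - log_likelihood lam \<theta>s t - e)
      \<le> ereal (1 / real n) * ln_ennreal (emeasure (posterior lam \<nu> \<Theta> n (x n)) A)"
proof -
  define S where "S = log_likelihood lam \<theta>s t"
  define f where "f = log_likelihood lam \<theta>1 t"
  obtain U where "openin (top_of_set \<Theta>) U" "\<theta>1 \<in> U" "U \<subseteq> A"
    using \<theta>1 unfolding interior_of_def by blast
  then obtain p where p: "p > 0" and num: "\<forall>\<^sub>F n in sequentially.
      ennreal (p * exp (real n * (f - e / 3))) \<le> likelihood_mass (x n) n A"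
    using eventually_likelihood_mass_ge[OF x, of "e / 3" U \<theta>1 A] e unfolding f_def by auto
  have den: "\<forall>\<^sub>F n in sequentially. likelihood_mass (x n) n \<Theta> \<le> ennreal (exp (real n * (S + e / 3)))"
    using eventually_likelihood_mass_le[OF x t support_subset _ \<theta>s, of "e / 3"] e unfolding S_def by simp
  have "\<forall>\<^sub>F n in sequentially. - ln p / (e / 3) \<le> real n"
    by real_asymp
  then have prefactor: "\<forall>\<^sub>F n in sequentially. - ln p \<le> real n * (e / 3)"
    by eventually_elim (use e in \<open>simp add: field_simps\<close>)
  have "\<forall>\<^sub>F n in sequentially. x n \<in> mean_domain lam"
    using x open_mean_domain t by (rule topological_tendstoD)
  then have "\<forall>\<^sub>F n in sequentially. ereal (f - S - e)
      \<le> ereal (1 / real n) * ln_ennreal (emeasure (posterior lam \<nu> \<Theta> n (x n)) A)"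
    using den num prefactor eventually_gt_at_top[of 0]
  proof eventually_elim
    case (elim n)
    let ?N = "p * exp (real n * (f - e / 3))" and ?D = "exp (real n * (S + e / 3))"
    have "exp (real n * (f - S - e)) \<le> exp (real n * (f - S - 2 * (e / 3)) + ln p)"
      using elim(4) by (simp add: algebra_simps)
    also have "real n * (f - S - 2 * (e / 3)) + ln p =
        ln p + real n * (f - e / 3) - real n * (S + e / 3)"
      by (simp add: algebra_simps)
    also have "exp \<dots> = ?N / ?D"
      using p by (simp only: exp_diff exp_add exp_ln)
    finally have "ennreal (exp (real n * (f - S - e))) \<le> ennreal (?N / ?D)" by (rule ennreal_leI)
    also have "\<dots> = ennreal ?N / ennreal ?D"
      using p by (intro divide_ennreal[symmetric]) auto
    also have "\<dots> \<le> likelihood_mass (x n) n A / likelihood_mass (x n) n \<Theta>"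
      using elim by (intro divide_mono_ennreal)
    also have "\<dots> = emeasure (posterior lam \<nu> \<Theta> n (x n)) A"
      using elim A by (intro emeasure_posterior[symmetric])
    finally show ?case using elim by (intro le_scaled_ln_ennreal)
  qed
  then show ?thesis unfolding f_def S_def .
qed

lemma good_rate_function_likelihood:
  assumes t: "t \<in> mean_domain lam"
    and \<theta>s: "\<And>\<theta>. \<theta> \<in> \<Theta> \<Longrightarrow> log_likelihood lam \<theta> t \<le> log_likelihood lam \<theta>s t"
  shows "good_rate_function (top_of_set \<Theta>)
    (\<lambda>\<theta>. ereal (log_likelihood lam \<theta>s t - log_likelihood lam \<theta> t))"
  unfolding good_rate_function_def lower_semicontinuous_map_def
proof (intro conjI allI impI ballI)
  fix c :: real
  let ?J = "\<lambda>\<theta>. log_likelihood lam \<theta>s t - log_likelihood lam \<theta> t"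
  have "continuous_on \<Theta> ?J"
    unfolding log_likelihood_def using support_subset
    by (intro continuous_intros continuous_at_imp_continuous_on) (auto intro: isCont_cgf)
  then have "openin (top_of_set \<Theta>) (\<Theta> \<inter> ?J -` {c<..})"
    by (intro continuous_openin_preimage_gen) auto
  then show "openin (top_of_set \<Theta>) {\<theta> \<in> topspace (top_of_set \<Theta>). ereal c < ereal (?J \<theta>)}"
    by (simp add: vimage_def Int_def)
next
  fix \<eta> :: real
  let ?K = "{\<theta> \<in> \<Theta>0. \<kappa> \<theta> - \<theta> \<bullet> t \<le> \<eta> - log_likelihood lam \<theta>s t}"
  obtain T where T: "closed T" "\<Theta> = \<Theta>0 \<inter> T"
    using closedin_support_in[OF sets_prior] unfolding closedin_closed by auto
  have "{\<theta> \<in> \<Theta>. log_likelihood lam \<theta>s t - log_likelihood lam \<theta> t \<le> \<eta>} = ?K \<inter> T"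
    unfolding T(2) by (auto simp: log_likelihood_def)
  moreover have "compact (?K \<inter> T)"
    using compact_sublevel[OF t] T(1) by (rule compact_Int_closed)
  ultimately show "compactin (top_of_set \<Theta>) {\<theta> \<in> topspace (top_of_set \<Theta>).
      ereal (log_likelihood lam \<theta>s t - log_likelihood lam \<theta> t) \<le> ereal \<eta>}"
    by (auto simp: compactin_subtopology)
qed (use \<theta>s in auto)

lemma log_likelihood_attains_max:
  assumes t: "t \<in> mean_domain lam"
  shows "\<exists>\<theta>s\<in>\<Theta>. \<forall>\<theta>\<in>\<Theta>. log_likelihood lam \<theta> t \<le> log_likelihood lam \<theta>s t"
proof -
  obtain \<theta>1 where \<theta>1: "\<theta>1 \<in> \<Theta>" using support_nonempty by blast
  obtain T where T: "closed T" "\<Theta> = \<Theta>0 \<inter> T"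
    using closedin_support_in[OF sets_prior] unfolding closedin_closed by auto
  define K where "K = {\<theta> \<in> \<Theta>0. \<kappa> \<theta> - \<theta> \<bullet> t \<le> \<kappa> \<theta>1 - \<theta>1 \<bullet> t} \<inter> T"
  have "compact K"
    unfolding K_def using compact_sublevel[OF t] T(1) by (rule compact_Int_closed)
  moreover have "\<theta>1 \<in> K" using \<theta>1 T(2) by (auto simp: K_def)
  moreover have "continuous_on K (\<lambda>\<theta>. log_likelihood lam \<theta> t)"
    unfolding log_likelihood_def
    by (intro continuous_intros continuous_at_imp_continuous_on) (auto simp: K_def intro: isCont_cgf)
  ultimately obtain \<theta>s where \<theta>s: "\<theta>s \<in> K"
    and max: "\<And>\<theta>. \<theta> \<in> K \<Longrightarrow> log_likelihood lam \<theta> t \<le> log_likelihood lam \<theta>s t"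
    using continuous_attains_sup[of K "\<lambda>\<theta>. log_likelihood lam \<theta> t"] by blast
  have "\<theta>s \<in> \<Theta>" using \<theta>s T(2) by (auto simp: K_def)
  moreover have "log_likelihood lam \<theta> t \<le> log_likelihood lam \<theta>s t" if "\<theta> \<in> \<Theta>" for \<theta>
  proof (cases "\<theta> \<in> K")
    case False
    then have "log_likelihood lam \<theta> t \<le> log_likelihood lam \<theta>1 t"
      using that T(2) by (auto simp: K_def log_likelihood_def)
    also have "\<dots> \<le> log_likelihood lam \<theta>s t" by (rule max) fact
    finally show ?thesis .
  qed (rule max)
  ultimately show ?thesis by blast
qed

text \<open>The exponential rates of numerator and denominator are combined, and \<open>e\<close> tends to zero. The lower
  bound \<open>- z\<close> on the infimum over the closure is kept real so that an empty closure, where the infimum is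
  infinite, needs no separate treatment.\<close>

theorem posterior_large_deviation_principle:
  assumes x: "x \<longlonglongrightarrow> t" and t: "t \<in> mean_domain lam" and \<theta>s: "\<theta>s \<in> \<Theta>"
    and max: "\<And>\<theta>. \<theta> \<in> \<Theta> \<Longrightarrow> log_likelihood lam \<theta> t \<le> log_likelihood lam \<theta>s t"
  shows "large_deviation_principle (top_of_set \<Theta>) (\<lambda>n. posterior lam \<nu> \<Theta> n (x n))
    (\<lambda>\<theta>. ereal (log_likelihood lam \<theta>s t - log_likelihood lam \<theta> t))"
  unfolding large_deviation_principle_def
proof (intro conjI ballI)
  let ?J = "\<lambda>\<theta>. ereal (log_likelihood lam \<theta>s t - log_likelihood lam \<theta> t)"
  have "\<forall>\<^sub>F n in sequentially. x n \<in> mean_domain lam"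
    using x open_mean_domain t by (rule topological_tendstoD)
  then show "\<forall>\<^sub>F n in sequentially. prob_space (posterior lam \<nu> \<Theta> n (x n)) \<and>
      space (posterior lam \<nu> \<Theta> n (x n)) = topspace (top_of_set \<Theta>) \<and>
      sets (posterior lam \<nu> \<Theta> n (x n)) = borel_sets_of (top_of_set \<Theta>)"
    by eventually_elim (simp add: prob_space_posterior space_posterior sets_posterior)
  show "good_rate_function (top_of_set \<Theta>) ?J"
    using t max by (rule good_rate_function_likelihood)
  fix A assume A: "A \<in> borel_sets_of (top_of_set \<Theta>)"
  let ?a = "\<lambda>n. ereal (1 / real n) * ln_ennreal (emeasure (posterior lam \<nu> \<Theta> n (x n)) A)"
  show "liminf ?a \<le> limsup ?a" by (simp add: Liminf_le_Limsup)
  have "- liminf ?a \<le> (INF \<theta>\<in>top_of_set \<Theta> interior_of A. ?J \<theta>)"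
  proof (rule INF_greatest)
    fix \<theta>1 assume \<theta>1: "\<theta>1 \<in> top_of_set \<Theta> interior_of A"
    have "- ?J \<theta>1 \<le> liminf ?a"
    proof (rule ereal_le_epsilon2)
      fix e :: real assume e: "0 < e"
      have "ereal (log_likelihood lam \<theta>1 t - log_likelihood lam \<theta>s t - e) \<le> liminf ?a"
        using eventually_posterior_ge[OF x t A e \<theta>1 max] by (intro Liminf_bounded)
      then show "- ?J \<theta>1 \<le> liminf ?a + ereal e"
        by (cases "liminf ?a") auto
    qed
    then show "- liminf ?a \<le> ?J \<theta>1" by (simp only: ereal_uminus_le_reorder)
  qed
  then show "- (INF \<theta>\<in>top_of_set \<Theta> interior_of A. ?J \<theta>) \<le> liminf ?a"
    by (simp only: ereal_uminus_le_reorder)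
  show "limsup ?a \<le> - (INF \<theta>\<in>top_of_set \<Theta> closure_of A. ?J \<theta>)"
  proof (rule ereal_le_real)
    fix z assume "- (INF \<theta>\<in>top_of_set \<Theta> closure_of A. ?J \<theta>) \<le> ereal z"
    then have z: "ereal (- z) \<le> (INF \<theta>\<in>top_of_set \<Theta> closure_of A. ?J \<theta>)"
      by (simp add: ereal_uminus_le_reorder)
    have "A \<subseteq> top_of_set \<Theta> closure_of A"
      using A borel_sets_of_support by (intro closure_of_subset) auto
    then have c: "log_likelihood lam \<theta> t \<le> log_likelihood lam \<theta>s t - - z" if "\<theta> \<in> A" for \<theta>
      using order_trans[OF z INF_lower[of \<theta>]] that by auto
    show "limsup ?a \<le> ereal z"
    proof (rule ereal_le_epsilon2)
      fix e :: real assume e: "0 < e"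
      have "limsup ?a \<le> ereal (e - - z)"
        using eventually_posterior_le[OF x t A \<theta>s e c] by (intro Limsup_bounded)
      then show "limsup ?a \<le> ereal z + ereal e" by (simp add: add.commute)
    qed
  qed
qed

lemma m_projection_iff:
  assumes \<theta>0: "\<theta>0 \<in> \<Theta>0"
  shows "m_projection lam \<Theta> \<theta>0 \<theta>s \<longleftrightarrow> \<theta>s \<in> \<Theta> \<and>
    (\<forall>\<theta>\<in>\<Theta>. log_likelihood lam \<theta> (mean \<theta>0) \<le> log_likelihood lam \<theta>s (mean \<theta>0))"
proof (cases "\<theta>s \<in> \<Theta>")
  case True
  have "kl lam \<theta>0 \<theta>s \<le> kl lam \<theta>0 \<theta> \<longleftrightarrow>
      log_likelihood lam \<theta> (mean \<theta>0) \<le> log_likelihood lam \<theta>s (mean \<theta>0)" if "\<theta> \<in> \<Theta>" for \<theta>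
    using kl_diff_eq[OF \<theta>0, of \<theta> \<theta>s] True that support_subset by (auto simp: subset_iff)
  then show ?thesis using True by (auto simp: m_projection_def)
qed (simp add: m_projection_def)

end

theorem theorem2p1:
  fixes lam \<nu> :: "'a::euclidean_space measure"
    and \<Theta> :: "'a set"
    and xbar :: "nat \<Rightarrow> 'a"
    and \<mu>0 \<theta>0 :: 'a
  assumes "sets lam = sets borel"
    and "sigma_finite_measure lam"
    and "not_affinely_concentrated lam"
    and "natural_domain lam \<noteq> {}"
    and "open (natural_domain lam)"
    and "sets \<nu> = sets (restrict_space borel (natural_domain lam))"
    and "prob_space \<nu>"
    and "\<Theta> = support_in (top_of_set (natural_domain lam)) \<nu>"
    and "xbar \<longlonglongrightarrow> \<mu>0"
    and "\<mu>0 \<in> mean_domain lam"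
    and "\<theta>0 \<in> natural_domain lam"
    and "\<mu>0 = grad (cgf_real lam) \<theta>0"
  shows "(\<forall>n. xbar n \<in> mean_domain lam \<longrightarrow> prob_space (posterior lam \<nu> \<Theta> n (xbar n))) \<and>
    (\<forall>\<^sub>F n in sequentially. xbar n \<in> mean_domain lam) \<and>
    (\<exists>\<theta>s. m_projection lam \<Theta> \<theta>0 \<theta>s) \<and>
    (\<forall>\<theta>s. m_projection lam \<Theta> \<theta>0 \<theta>s \<longrightarrow>
      large_deviation_principle (top_of_set \<Theta>)
        (\<lambda>n. posterior lam \<nu> \<Theta> n (xbar n))
        (\<lambda>\<theta>. ereal (kl lam \<theta>0 \<theta> - kl lam \<theta>0 \<theta>s)))"
proof -
  interpret prob_space \<nu> by fact
  interpret exponential_family_prior lam \<nu>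
    by (intro exponential_family_prior.intro regular_exponential_family.intro
        exponential_family_prior_axioms.intro) fact+
  note \<Theta> = assms(8) and x = assms(9) and \<mu>0 = assms(10) and \<theta>0 = assms(11)
  have mean: "\<mu>0 = mean \<theta>0" using assms(12) grad_cgf[OF \<theta>0] by simp
  show ?thesis
    unfolding \<Theta>
  proof (intro conjI allI impI)
    show "\<And>n. xbar n \<in> mean_domain lam \<Longrightarrow>
        prob_space (posterior lam \<nu> (support_in (top_of_set (natural_domain lam)) \<nu>) n (xbar n))"
      by (rule prob_space_posterior)
    show "\<forall>\<^sub>F n in sequentially. xbar n \<in> mean_domain lam"
      using x open_mean_domain \<mu>0 by (rule topological_tendstoD)
    show "\<exists>\<theta>s. m_projection lam (support_in (top_of_set (natural_domain lam)) \<nu>) \<theta>0 \<theta>s"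
      using log_likelihood_attains_max[OF \<mu>0] unfolding m_projection_iff[OF \<theta>0] mean by blast
  next
    fix \<theta>s assume "m_projection lam (support_in (top_of_set (natural_domain lam)) \<nu>) \<theta>0 \<theta>s"
    then have \<theta>s: "\<theta>s \<in> support_in (top_of_set (natural_domain lam)) \<nu>"
      and max: "\<And>\<theta>. \<theta> \<in> support_in (top_of_set (natural_domain lam)) \<nu> \<Longrightarrow>
        log_likelihood lam \<theta> \<mu>0 \<le> log_likelihood lam \<theta>s \<mu>0"
      unfolding m_projection_iff[OF \<theta>0] mean by blast+
    have "kl lam \<theta>0 \<theta> - kl lam \<theta>0 \<theta>s = log_likelihood lam \<theta>s \<mu>0 - log_likelihood lam \<theta> \<mu>0"
      if "\<theta> \<in> support_in (top_of_set (natural_domain lam)) \<nu>" for \<theta>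
      using kl_diff_eq[OF \<theta>0] that \<theta>s support_subset unfolding mean by blast
    then show "large_deviation_principle
        (top_of_set (support_in (top_of_set (natural_domain lam)) \<nu>))
        (\<lambda>n. posterior lam \<nu> (support_in (top_of_set (natural_domain lam)) \<nu>) n (xbar n))
        (\<lambda>\<theta>. ereal (kl lam \<theta>0 \<theta> - kl lam \<theta>0 \<theta>s))"
      using posterior_large_deviation_principle[OF x \<mu>0 \<theta>s max]
      by (subst large_deviation_principle_cong) auto
  qed
qed

end
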